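(* Let $\Gamma$ be a signed graph of order $n$ such that each connected component of $\Gamma$ has at least two vertices. Then $$i_+(\Gamma)=\frac{n-p(\Gamma)}{2}-\theta(\Gamma)$$ if and only if $\Gamma$ is a disjoint union of signed cycles $C_{n_1}^\sigma\cup C_{n_2}^\sigma\cup\cdots\cup C_{n_t}^\sigma$, where $n_1+n_2+\cdots+n_t=n$ and, for each $i\in\{1,2,\ldots,t\}$, $n_i\equiv 0\pmod 4$ if $C_{n_i}^\sigma$ is balanced and $n_i\equiv 2\pmod 4$ if $C_{n_i}^\sigma$ is unbalanced.
   Context: All graphs are finite and simple. A signed graph $\Gamma=(G,\sigma)$ consists of a simple graph $G=(V(G),E(G))$ (the underlying graph) and a sign function $\sigma:E(G)\to\{+,-\}$. Its order is $n=|V(G)|$. Graph-theoretic notions for $\Gamma$ (connectedness, degree, cycles, components) refer to $G$. The adjacency matrix $A(\Gamma)$ is the real symmetric matrix indexed by $V(G)$ whose $(u,v)$ entry is $+1$ if $uv\in E(G)$ and $\sigma(uv)=+$, $-1$ if $uv\in E(G)$ and $\sigma(uv)=-$, and $0$ if $uv\notin E(G)$. The positive inertia index $i_+(\Gamma)$ is the number of positive eigenvalues of $A(\Gamma)$, counted with multiplicity. The cyclomatic number is $\theta(\Gamma)=|E(G)|-|V(G)|+c(G)$, where $c(G)$ is the number of connected components of $G$. A pendant vertex is a vertex of degree $1$, and $p(\Gamma)$ denotes the number of pendant vertices of $\Gamma$. $C_m^\sigma$ denotes a signed graph whose underlying graph is the cycle with $m$ vertices ($m\ge 3$). The sign of a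 signed cycle is the product of the signs of its edges; the signed cycle $C_m^\sigma$ is balanced if its sign is $+$ and unbalanced if its sign is $-$. *)

theory Defs
  imports "Jordan_Normal_Form.Char_Poly" "HOL-Library.Disjoint_Sets"
begin

text \<open>
  A signed graph is given by its vertex set, its set of (two-element) edges and its sign function,
  with the signs \<open>+\<close> and \<open>-\<close> represented by the integers 1 and -1.  The values of the
  sign function outside the edge set are irrelevant.
\<close>

record 'a sgraph =
  verts :: "'a set"
  edges :: "'a set set"
  esign :: "'a set \<Rightarrow> int"

definition signed_graph :: "('a, 'b) sgraph_scheme \<Rightarrow> bool" where
  "signed_graph \<Gamma> \<longleftrightarrow>
     finite (verts \<Gamma>) \<and>
     (\<forall>e \<in> edges \<Gamma>. e \<subseteq> verts \<Gamma> \<and> card e = 2) \<and>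
     (\<forall>e \<in> edges \<Gamma>. esign \<Gamma> e = 1 \<or> esign \<Gamma> e = -1)"

definition adjacent :: "('a, 'b) sgraph_scheme \<Rightarrow> 'a \<Rightarrow> 'a \<Rightarrow> bool" where
  "adjacent \<Gamma> u v \<longleftrightarrow> {u, v} \<in> edges \<Gamma>"

definition components :: "('a, 'b) sgraph_scheme \<Rightarrow> 'a set set" where
  "components \<Gamma> =
     verts \<Gamma> // {(u, v). u \<in> verts \<Gamma> \<and> v \<in> verts \<Gamma> \<and> (adjacent \<Gamma>)\<^sup>*\<^sup>* u v}"

definition degree_of :: "('a, 'b) sgraph_scheme \<Rightarrow> 'a \<Rightarrow> nat" where
  "degree_of \<Gamma> v = card {e \<in> edges \<Gamma>. v \<in> e}"

definition num_pendant :: "('a, 'b) sgraph_scheme \<Rightarrow> nat" where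
  "num_pendant \<Gamma> = card {v \<in> verts \<Gamma>. degree_of \<Gamma> v = 1}"

definition cyclomatic :: "('a, 'b) sgraph_scheme \<Rightarrow> int" where
  "cyclomatic \<Gamma> =
     int (card (edges \<Gamma>)) - int (card (verts \<Gamma>)) + int (card (components \<Gamma>))"

definition adj_entry :: "('a, 'b) sgraph_scheme \<Rightarrow> 'a \<Rightarrow> 'a \<Rightarrow> real" where
  "adj_entry \<Gamma> u v = (if {u, v} \<in> edges \<Gamma> then real_of_int (esign \<Gamma> {u, v}) else 0)"

text \<open>
  Library matrices are indexed by initial segments of the naturals, so the vertices have to be
  enumerated.  The spectrum does not depend on the enumeration chosen; see
  \<open>char_poly_adj_matrix_wrt\<close> below.
\<close>

definition adj_matrix_wrt :: "(nat \<Rightarrow> 'a) \<Rightarrow> ('a, 'b) sgraph_scheme \<Rightarrow> real mat" where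
  "adj_matrix_wrt f \<Gamma> =
     mat (card (verts \<Gamma>)) (card (verts \<Gamma>)) (\<lambda>(i, j). adj_entry \<Gamma> (f i) (f j))"

definition adj_matrix :: "('a, 'b) sgraph_scheme \<Rightarrow> real mat" where
  "adj_matrix \<Gamma> =
     adj_matrix_wrt (SOME f. bij_betw f {..<card (verts \<Gamma>)} (verts \<Gamma>)) \<Gamma>"

text \<open>
  Multiplicities are taken in the characteristic polynomial; as the adjacency matrix is real
  symmetric, they agree with the dimensions of the eigenspaces.
\<close>

definition pos_inertia :: "('a, 'b) sgraph_scheme \<Rightarrow> nat" where
  "pos_inertia \<Gamma> =
     (\<Sum>x \<in> {x. eigenvalue (adj_matrix \<Gamma>) x \<and> 0 < x}. order x (char_poly (adj_matrix \<Gamma>)))"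

definition signed_cycle :: "nat \<Rightarrow> ('a, 'b) sgraph_scheme \<Rightarrow> bool" where
  "signed_cycle m C \<longleftrightarrow>
     signed_graph C \<and> 3 \<le> m \<and>
     (\<exists>f. bij_betw f {..<m} (verts C) \<and> edges C = (\<lambda>i. {f i, f (Suc i mod m)}) ` {..<m})"

definition cycle_sign :: "('a, 'b) sgraph_scheme \<Rightarrow> int" where
  "cycle_sign C = (\<Prod>e \<in> edges C. esign C e)"

definition balanced_cycle :: "('a, 'b) sgraph_scheme \<Rightarrow> bool" where
  "balanced_cycle C \<longleftrightarrow> cycle_sign C = 1"

definition unbalanced_cycle :: "('a, 'b) sgraph_scheme \<Rightarrow> bool" where
  "unbalanced_cycle C \<longleftrightarrow> cycle_sign C = -1"

definition is_disjoint_union ::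
    "('a, 'b) sgraph_scheme \<Rightarrow> 'i set \<Rightarrow> ('i \<Rightarrow> ('a, 'c) sgraph_scheme) \<Rightarrow> bool" where
  "is_disjoint_union \<Gamma> I H \<longleftrightarrow>
     disjoint_family_on (\<lambda>i. verts (H i)) I \<and>
     verts \<Gamma> = (\<Union>i\<in>I. verts (H i)) \<and>
     edges \<Gamma> = (\<Union>i\<in>I. edges (H i)) \<and>
     (\<forall>i\<in>I. \<forall>e \<in> edges (H i). esign \<Gamma> e = esign (H i) e)"

lemma char_poly_adj_matrix_wrt:
  assumes "bij_betw f {..<card (verts \<Gamma>)} (verts \<Gamma>)"
  shows "char_poly (adj_matrix \<Gamma>) = char_poly (adj_matrix_wrt f \<Gamma>)"
proof -
  define n where "n = card (verts \<Gamma>)"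
  define g where "g = (SOME f. bij_betw f {..<card (verts \<Gamma>)} (verts \<Gamma>))"
  have f: "bij_betw f {..<n} (verts \<Gamma>)" using assms by (simp add: n_def)
  have g: "bij_betw g {..<n} (verts \<Gamma>)"
    unfolding g_def n_def by (rule someI[of _ f]) (rule assms)
  define A where "A = adj_matrix_wrt g \<Gamma>"
  define B where "B = adj_matrix_wrt f \<Gamma>"
  define h where "h i = the_inv_into {..<n} f (g i)" for i
  define k where "k j = the_inv_into {..<n} g (f j)" for j
  have h: "h i < n" "f (h i) = g i" "k (h i) = i" if "i < n" for i
  proof -
    have "g i \<in> f ` {..<n}" using f g that by (auto simp: bij_betw_def)
    then show "h i < n" "f (h i) = g i"
      using the_inv_into_into[of f "{..<n}" "g i" "{..<n}"] f
      by (auto simp: h_def bij_betw_def f_the_inv_into_f)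
    then show "k (h i) = i"
      using g that by (auto simp: k_def bij_betw_def the_inv_into_f_f)
  qed
  have k: "k i < n" "g (k i) = f i" "h (k i) = i" if "i < n" for i
  proof -
    have "f i \<in> g ` {..<n}" using f g that by (auto simp: bij_betw_def)
    then show "k i < n" "g (k i) = f i"
      using the_inv_into_into[of g "{..<n}" "f i" "{..<n}"] g
      by (auto simp: k_def bij_betw_def f_the_inv_into_f)
    then show "h (k i) = i"
      using f that by (auto simp: h_def bij_betw_def the_inv_into_f_f)
  qed
  define P where "P = mat n n (\<lambda>(i, j). if j = h i then 1 else 0 :: real)"
  define Q where "Q = mat n n (\<lambda>(i, j). if j = k i then 1 else 0 :: real)"
  have carr: "A \<in> carrier_mat n n" "B \<in> carrier_mat n n" "P \<in> carrier_mat n n" "Q \<in> carrier_mat n n"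
    by (auto simp: A_def B_def P_def Q_def adj_matrix_wrt_def n_def)
  have pick_left: "(\<Sum>l = 0..<n. (if l = a then 1 else 0) * F l) = F a"
    and pick_right: "(\<Sum>l = 0..<n. F l * (if l = a then 1 else 0)) = F a"
    if "a < n" for a and F :: "nat \<Rightarrow> real"
  proof -
    have "(\<Sum>l = 0..<n. (if l = a then 1 else 0) * F l) = (\<Sum>l = 0..<n. if l = a then F l else 0)"
      by (rule sum.cong) simp_all
    with that show "(\<Sum>l = 0..<n. (if l = a then 1 else 0) * F l) = F a"
      by simp
    then show "(\<Sum>l = 0..<n. F l * (if l = a then 1 else 0)) = F a"
      by (simp only: mult.commute)
  qed
  have kh_eq: "(j = k l) = (l = h j)" if "l < n" "j < n" for l j
    using h k that by metis
  have PX: "(P * X) $$ (i, j) = X $$ (h i, j)"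
    and QX: "(Q * X) $$ (i, j) = X $$ (k i, j)"
    if "X \<in> carrier_mat n n" "i < n" "j < n" for X i j
    using that h(1) k(1) by (simp_all add: P_def Q_def scalar_prod_def pick_left)
  have XQ: "(X * Q) $$ (i, j) = X $$ (i, h j)"
    if "X \<in> carrier_mat n n" "i < n" "j < n" for X i j
  proof -
    have "(X * Q) $$ (i, j) = (\<Sum>l = 0..<n. X $$ (i, l) * (if j = k l then 1 else 0))"
      using that by (simp add: Q_def scalar_prod_def)
    also have "\<dots> = (\<Sum>l = 0..<n. X $$ (i, l) * (if l = h j then 1 else 0))"
      by (rule sum.cong) (use that kh_eq in simp_all)
    also have "\<dots> = X $$ (i, h j)" by (rule pick_right) (use that h in simp)
    finally show ?thesis .
  qed
  have PQ: "P * Q = 1\<^sub>m n"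
  proof (rule eq_matI)
    fix i j assume "i < dim_row (1\<^sub>m n :: real mat)" "j < dim_col (1\<^sub>m n :: real mat)"
    then have ij: "i < n" "j < n" by auto
    then have "(P * Q) $$ (i, j) = Q $$ (h i, j)"
      using carr by (intro PX) auto
    also have "\<dots> = 1\<^sub>m n $$ (i, j)"
      using ij h(1)[OF ij(1)] h(3)[OF ij(1)] by (auto simp: Q_def)
    finally show "(P * Q) $$ (i, j) = 1\<^sub>m n $$ (i, j)" .
  qed (use carr in auto)
  have QP: "Q * P = 1\<^sub>m n"
  proof (rule eq_matI)
    fix i j assume "i < dim_row (1\<^sub>m n :: real mat)" "j < dim_col (1\<^sub>m n :: real mat)"
    then have ij: "i < n" "j < n" by auto
    then have "(Q * P) $$ (i, j) = P $$ (k i, j)"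
      using carr by (intro QX) auto
    also have "\<dots> = 1\<^sub>m n $$ (i, j)"
      using ij k(1)[OF ij(1)] k(3)[OF ij(1)] by (auto simp: P_def)
    finally show "(Q * P) $$ (i, j) = 1\<^sub>m n $$ (i, j)" .
  qed (use carr in auto)
  have "P * B * Q = A"
  proof (rule eq_matI)
    fix i j assume "i < dim_row A" "j < dim_col A"
    then have ij: "i < n" "j < n" using carr by auto
    have "(P * B * Q) $$ (i, j) = (P * B) $$ (i, h j)"
      using ij carr by (intro XQ) auto
    also have "\<dots> = B $$ (h i, h j)"
      using ij carr h(1) by (intro PX) auto
    also have "\<dots> = A $$ (i, j)"
      using ij h(1,2)[OF ij(1)] h(1,2)[OF ij(2)]
      by (simp add: A_def B_def adj_matrix_wrt_def n_def[symmetric])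
    finally show "(P * B * Q) $$ (i, j) = A $$ (i, j)" .
  qed (use carr in auto)
  then have "similar_mat_wit A B P Q"
    using carr PQ QP by (intro similar_mat_witI[of _ _ n]) simp_all
  then have "similar_mat A B"
    unfolding similar_mat_def by blast
  then show ?thesis
    unfolding adj_matrix_def g_def[symmetric] A_def B_def by (rule char_poly_similar)
qed

end

theory Submission imports Defs begin

text \<open>
  By the handshake lemma, twice the difference of the two sides is a sum over the components
  \<open>K\<close> of the numbers \<open>2 i\<^sub>+(K) + 2 + (\<Sum>x. \<phi> (deg x))\<close>, where \<open>\<phi> d = d - 3 + [d = 1]\<close>.  Such
  a number is nonnegative for a connected graph with at least two vertices, and zero exactly for
  the cycles in question, by induction on the order.  A pendant vertex is deleted, either alone or
  together with its neighbour, in which case \<open>i\<^sub>+\<close> drops by one.  Without pendant vertices, a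
  vertex that is not a cut vertex is deleted if it or one of its neighbours has degree at least 3.
  In the remaining case there are adjacent vertices \<open>u\<close>, \<open>v\<close> of degree 2.  Splitting off their
  hyperbolic plane contracts the path \<open>a - u - v - b\<close> to a single edge \<open>a - b\<close> and flips the sign
  of the product of the weights; this preserves the number as well as the class of extremal
  cycles.  Only triangles and quadrangles are left.
\<close>

section \<open>The positive index of a quadratic form\<close>

text \<open>The constant \<open>2\<close> in the summand does not depend on the size of a component,
  so splitting a component into \<open>k\<close> pieces would cost \<open>2 * (k - 1)\<close>; hence
  only deletions that leave the graph connected are used. Deleting a vertex of degree
  \<open>2\<close> costs \<open>1\<close>, as \<open>phi 2 = -1\<close>. A neighbour repays
  \<open>1\<close> if its degree is at least \<open>3\<close>, but nothing if its degree is
  \<open>2\<close>, because the lost edge is offset by a new pendant vertex. Where all degrees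
  involved are \<open>2\<close>, monotonicity of the index is therefore too weak by one unit, and a
  step with an exact change of the index is required. Eliminating \<open>u\<close> and
  \<open>v\<close> provides it: the Schur complement has the entry
  \<open>- W {a, u} * W {v, b} / W {u, v}\<close> between \<open>a\<close> and \<open>b\<close>,
  which is again a sign if \<open>a\<close> and \<open>b\<close> are distinct and not yet adjacent.
  The equality case has to travel with the bound, since strictness is drawn from it: a smaller graph
  has positive excess or is an extremal cycle, whose degrees are then known.\<close>

definition bil :: "('a \<Rightarrow> 'a \<Rightarrow> real) \<Rightarrow> 'a set \<Rightarrow> ('a \<Rightarrow> real) \<Rightarrow> ('a \<Rightarrow> real) \<Rightarrow> real" where
  "bil A V x y = (\<Sum>i\<in>V. \<Sum>j\<in>V. A i j * x i * y j)"

text \<open>The positive index of \<open>A\<close> on \<open>V\<close> is at least \<open>p\<close> if there are \<open>p\<close> vectors that are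
  orthonormal with respect to \<open>A\<close>, and at most \<open>p\<close> if \<open>p\<close> squares of linear forms dominate the
  quadratic form.  These two kinds of witnesses replace dimensions of subspaces.\<close>

definition lower_inertia :: "('a \<Rightarrow> 'a \<Rightarrow> real) \<Rightarrow> 'a set \<Rightarrow> nat \<Rightarrow> bool" where
  "lower_inertia A V p \<longleftrightarrow>
     (\<exists>X :: nat \<Rightarrow> 'a \<Rightarrow> real. \<forall>i<p. \<forall>j<p. bil A V (X i) (X j) = (if i = j then 1 else 0))"

definition upper_inertia :: "('a \<Rightarrow> 'a \<Rightarrow> real) \<Rightarrow> 'a set \<Rightarrow> nat \<Rightarrow> bool" where
  "upper_inertia A V p \<longleftrightarrow>
     (\<exists>L :: nat \<Rightarrow> 'a \<Rightarrow> real. \<forall>x. bil A V x x \<le> (\<Sum>k<p. (\<Sum>v\<in>V. L k v * x v)\<^sup>2))"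

definition inertia :: "('a \<Rightarrow> 'a \<Rightarrow> real) \<Rightarrow> 'a set \<Rightarrow> nat \<Rightarrow> bool" where
  "inertia A V p \<longleftrightarrow> lower_inertia A V p \<and> upper_inertia A V p"

section \<open>Sylvester's law of inertia for witnesses, and the calculus of the index\<close>

lemma bil_cong:
  assumes "\<And>i j. i \<in> V \<Longrightarrow> j \<in> V \<Longrightarrow> A i j = B i j"
    and "\<And>i. i \<in> V \<Longrightarrow> x i = x' i" "\<And>i. i \<in> V \<Longrightarrow> y i = y' i"
  shows "bil A V x y = bil B V x' y'"
  unfolding bil_def by (intro sum.cong refl) (simp add: assms)

lemma inertia_cong:
  assumes "\<And>i j. i \<in> V \<Longrightarrow> j \<in> V \<Longrightarrow> A i j = B i j"
  shows "inertia A V p = inertia B V p"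
proof -
  have "bil A V = bil B V" by (intro ext bil_cong) (auto simp: assms)
  then show ?thesis by (simp add: inertia_def lower_inertia_def upper_inertia_def)
qed

lemma bil_sum:
  assumes "finite V"
  shows "bil A V (\<lambda>v. \<Sum>i\<in>I. c i * X i v) (\<lambda>v. \<Sum>j\<in>J. d j * Y j v)
    = (\<Sum>i\<in>I. \<Sum>j\<in>J. c i * d j * bil A V (X i) (Y j))"
proof -
  have "bil A V (\<lambda>v. \<Sum>i\<in>I. c i * X i v) (\<lambda>v. \<Sum>j\<in>J. d j * Y j v)
      = (\<Sum>u\<in>V. \<Sum>v\<in>V. \<Sum>i\<in>I. \<Sum>j\<in>J. c i * d j * (A u v * X i u * Y j v))"
    unfolding bil_def mult.assoc sum_product unfolding sum_distrib_left
    by (intro sum.cong refl) (simp add: mult_ac)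
  also have "\<dots> = (\<Sum>u\<in>V. \<Sum>i\<in>I. \<Sum>v\<in>V. \<Sum>j\<in>J. c i * d j * (A u v * X i u * Y j v))"
    by (intro sum.cong refl sum.swap)
  also have "\<dots> = (\<Sum>u\<in>V. \<Sum>i\<in>I. \<Sum>j\<in>J. \<Sum>v\<in>V. c i * d j * (A u v * X i u * Y j v))"
    by (intro sum.cong refl sum.swap)
  also have "\<dots> = (\<Sum>i\<in>I. \<Sum>u\<in>V. \<Sum>j\<in>J. \<Sum>v\<in>V. c i * d j * (A u v * X i u * Y j v))"
    by (rule sum.swap)
  also have "\<dots> = (\<Sum>i\<in>I. \<Sum>j\<in>J. \<Sum>u\<in>V. \<Sum>v\<in>V. c i * d j * (A u v * X i u * Y j v))"
    by (intro sum.cong refl sum.swap)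
  finally show ?thesis by (simp add: bil_def sum_distrib_left)
qed

text \<open>Padding \<open>M\<close> with zero rows gives a square matrix whose row \<open>q\<close>
  vanishes; its determinant is zero, and a kernel vector solves the \<open>q\<close> equations in
  more than \<open>q\<close> unknowns.\<close>

lemma homogeneous_system:
  fixes M :: "nat \<Rightarrow> nat \<Rightarrow> real"
  assumes "q < p"
  shows "\<exists>c. (\<exists>i<p. c i \<noteq> 0) \<and> (\<forall>k<q. (\<Sum>i<p. M k i * c i) = 0)"
proof -
  define N where "N = mat p p (\<lambda>(k, i). if k < q then M k i else 0)"
  have N: "N \<in> carrier_mat p p" by (simp add: N_def)
  have "N $$ (q, i) = 0" if "i < p" for i
    using assms that by (simp add: N_def)
  then have "det N = 0"
    using laplace_expansion_row[OF N assms] by simp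
  then obtain v where v: "v \<in> carrier_vec p" "v \<noteq> 0\<^sub>v p" "N *\<^sub>v v = 0\<^sub>v p"
    using det_0_iff_vec_prod_zero[OF N] by auto
  have "\<exists>i<p. v $ i \<noteq> 0" using v(1,2) by (metis carrier_vecD eq_vecI index_zero_vec)
  moreover have "(\<Sum>i<p. M k i * v $ i) = 0" if "k < q" for k
  proof -
    have "0 = (N *\<^sub>v v) $ k" using that assms v(3) by simp
    also have "\<dots> = (\<Sum>i<p. M k i * v $ i)"
      using that assms v(1) by (simp add: N_def scalar_prod_def atLeast0LessThan)
    finally show ?thesis by simp
  qed
  ultimately show ?thesis by (intro exI[of _ "\<lambda>i. v $ i"]) blast
qed

text \<open>If \<open>q < p\<close>, some nontrivial combination of the \<open>p\<close> orthonormal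
  vectors is annihilated by all \<open>q\<close> linear forms. The form would be at most zero there,
  but its value is the sum of the squared coefficients. This is the core of Sylvester's law and
  makes the index unique.\<close>

lemma lower_le_upper:
  assumes V: "finite V" and "lower_inertia A V p" "upper_inertia A V q"
  shows "p \<le> q"
proof (rule ccontr)
  assume "\<not> p \<le> q"
  then have "q < p" by simp
  obtain X where X: "\<And>i j. i < p \<Longrightarrow> j < p \<Longrightarrow> bil A V (X i) (X j) = (if i = j then 1 else 0)"
    using assms(2) by (auto simp: lower_inertia_def)
  obtain L where L: "\<And>x. bil A V x x \<le> (\<Sum>k<q. (\<Sum>v\<in>V. L k v * x v)\<^sup>2)"
    using assms(3) by (auto simp: upper_inertia_def)
  obtain c where c: "\<exists>i<p. c i \<noteq> 0" "\<And>k. k < q \<Longrightarrow> (\<Sum>i<p. (\<Sum>v\<in>V. L k v * X i v) * c i) = 0"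
    using homogeneous_system[OF \<open>q < p\<close>, of "\<lambda>k i. \<Sum>v\<in>V. L k v * X i v"] by auto
  define x where "x = (\<lambda>v. \<Sum>i<p. c i * X i v)"
  have "(\<Sum>v\<in>V. L k v * x v) = 0" if "k < q" for k
  proof -
    have "(\<Sum>v\<in>V. L k v * x v) = (\<Sum>v\<in>V. \<Sum>i<p. L k v * X i v * c i)"
      unfolding x_def sum_distrib_left by (simp add: mult_ac)
    also have "\<dots> = (\<Sum>i<p. \<Sum>v\<in>V. L k v * X i v * c i)" by (rule sum.swap)
    finally show ?thesis using c(2)[OF that] by (simp add: sum_distrib_right)
  qed
  then have "bil A V x x \<le> 0" using L[of x] by simp
  moreover have "bil A V x x = (\<Sum>i<p. \<Sum>j<p. c i * c j * bil A V (X i) (X j))"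
    unfolding x_def by (rule bil_sum[OF V])
  also have "\<dots> = (\<Sum>i<p. \<Sum>j<p. if j = i then c i * c i else 0)"
    by (intro sum.cong refl) (auto simp: X)
  also have "\<dots> = (\<Sum>i<p. c i * c i)" by simp
  moreover have "(\<Sum>i<p. c i * c i) > 0"
    using c(1) by (auto intro!: sum_pos2 simp: zero_less_mult_iff)
  ultimately show False by simp
qed

lemma inertia_unique:
  "finite V \<Longrightarrow> inertia A V p \<Longrightarrow> inertia A V q \<Longrightarrow> p = q"
  by (meson inertia_def le_antisym lower_le_upper)

text \<open>Orthonormal vectors stay orthonormal when extended by zero. For graphs this is the part
  of interlacing that is used when vertices are deleted.\<close>

lemma inertia_mono:
  assumes "finite V" "U \<subseteq> V" "inertia A U p" "inertia A V q"
  shows "p \<le> q"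
proof -
  obtain X where X: "\<And>i j. i < p \<Longrightarrow> j < p \<Longrightarrow> bil A U (X i) (X j) = (if i = j then 1 else 0)"
    using assms(3) by (auto simp: inertia_def lower_inertia_def)
  have "bil A V (\<lambda>v. if v \<in> U then x v else 0) (\<lambda>v. if v \<in> U then y v else 0) = bil A U x y" for x y
  proof -
    have "bil A V (\<lambda>v. if v \<in> U then x v else 0) (\<lambda>v. if v \<in> U then y v else 0)
      = (\<Sum>i\<in>V. if i \<in> U then (\<Sum>j\<in>V. if j \<in> U then A i j * x i * y j else 0) else 0)"
      unfolding bil_def by (intro sum.cong refl) (auto intro!: sum.cong)
    also have "\<dots> = bil A U x y"
      using assms(1,2) by (simp add: bil_def sum.If_cases Int_absorb1)
    finally show ?thesis .
  qed
  then have "lower_inertia A V p"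
    unfolding lower_inertia_def using X
    by (intro exI[of _ "\<lambda>i v. if v \<in> U then X i v else 0"]) simp
  then show ?thesis using assms(1,4) lower_le_upper by (auto simp: inertia_def)
qed

lemma inertia_reindex:
  assumes f: "inj_on f U" and "inertia (\<lambda>i j. A (f i) (f j)) U p"
  shows "inertia A (f ` U) p"
proof -
  let ?B = "\<lambda>i j. A (f i) (f j)" and ?g = "the_inv_into U f"
  have g: "?g (f i) = i" if "i \<in> U" for i using f that by (rule the_inv_into_f_f)
  have bil: "bil A (f ` U) x y = bil ?B U (x \<circ> f) (y \<circ> f)" for x y
    unfolding bil_def by (simp add: sum.reindex[OF f])
  obtain X where X: "\<And>i j. i < p \<Longrightarrow> j < p \<Longrightarrow> bil ?B U (X i) (X j) = (if i = j then 1 else 0)"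
    using assms(2) by (auto simp: inertia_def lower_inertia_def)
  have "bil A (f ` U) (X i \<circ> ?g) (X j \<circ> ?g) = bil ?B U (X i) (X j)" for i j
    unfolding bil by (rule bil_cong) (auto simp: g)
  then have low: "lower_inertia A (f ` U) p"
    unfolding lower_inertia_def using X by (intro exI[of _ "\<lambda>i. X i \<circ> ?g"]) simp
  obtain L where L: "\<And>x. bil ?B U x x \<le> (\<Sum>k<p. (\<Sum>v\<in>U. L k v * x v)\<^sup>2)"
    using assms(2) by (auto simp: inertia_def upper_inertia_def)
  have "(\<Sum>v\<in>f ` U. (L k \<circ> ?g) v * x v) = (\<Sum>v\<in>U. L k v * (x \<circ> f) v)" for k x
    by (simp add: sum.reindex[OF f] g)
  then have "bil A (f ` U) x x \<le> (\<Sum>k<p. (\<Sum>v\<in>f ` U. (L k \<circ> ?g) v * x v)\<^sup>2)" for x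
    unfolding bil by (simp only: L)
  then have "upper_inertia A (f ` U) p"
    unfolding upper_inertia_def by (intro exI[of _ "\<lambda>k. L k \<circ> ?g"]) blast
  with low show ?thesis by (simp add: inertia_def)
qed

text \<open>The two blocks do not interact, so both kinds of witnesses, extended by zero, can be
  concatenated; the second family is shifted by \<open>p\<close>.\<close>

lemma inertia_disjoint_union:
  assumes "finite U" "finite V" "U \<inter> V = {}"
    and cross: "\<And>i j. i \<in> U \<Longrightarrow> j \<in> V \<Longrightarrow> A i j = 0 \<and> A j i = 0"
    and "inertia A U p" "inertia A V q"
  shows "inertia A (U \<union> V) (p + q)"
proof -
  have bil: "bil A (U \<union> V) x y = bil A U x y + bil A V x y" for x y
  proof -
    have "(\<Sum>j\<in>U \<union> V. A i j * x i * y j) = (\<Sum>j\<in>U. A i j * x i * y j)" if "i \<in> U" for i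
      using assms(1-3) cross[OF that] by (subst sum.union_disjoint) auto
    moreover have "(\<Sum>j\<in>U \<union> V. A i j * x i * y j) = (\<Sum>j\<in>V. A i j * x i * y j)" if "i \<in> V" for i
      using assms(1-3) cross[OF _ that] by (subst sum.union_disjoint) auto
    ultimately show ?thesis
      unfolding bil_def using assms(1-3) by (subst sum.union_disjoint) auto
  qed
  have zero: "bil A S x y = 0" if "\<forall>i\<in>S. x i = 0 \<or> (\<forall>j\<in>S. y j = 0)" for S x y
    unfolding bil_def using that by (intro sum.neutral ballI) auto
  obtain X where X: "\<And>i j. i < p \<Longrightarrow> j < p \<Longrightarrow> bil A U (X i) (X j) = (if i = j then 1 else 0)"
    using assms(5) by (auto simp: inertia_def lower_inertia_def)
  obtain Y where Y: "\<And>i j. i < q \<Longrightarrow> j < q \<Longrightarrow> bil A V (Y i) (Y j) = (if i = j then 1 else 0)"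
    using assms(6) by (auto simp: inertia_def lower_inertia_def)
  define Z where "Z = (\<lambda>i v. if i < p then (if v \<in> U then X i v else 0)
                             else (if v \<in> V then Y (i - p) v else 0))"
  have disj: "v \<notin> V" if "v \<in> U" for v using that assms(3) by blast
  have disj': "v \<notin> U" if "v \<in> V" for v using that assms(3) by blast
  have "bil A (U \<union> V) (Z i) (Z j) = (if i = j then 1 else 0)" if "i < p + q" "j < p + q" for i j
  proof -
    have U: "bil A U (Z i) (Z j) = (if i < p \<and> j < p then bil A U (X i) (X j) else 0)"
      by (auto simp: Z_def disj intro!: zero bil_cong)
    have V: "bil A V (Z i) (Z j)
        = (if i \<ge> p \<and> j \<ge> p then bil A V (Y (i - p)) (Y (j - p)) else 0)"
      by (auto simp: Z_def disj' intro!: zero bil_cong)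
    show ?thesis unfolding bil U V using that by (auto simp: X Y)
  qed
  then have low: "lower_inertia A (U \<union> V) (p + q)"
    unfolding lower_inertia_def by blast
  obtain L where L: "\<And>x. bil A U x x \<le> (\<Sum>k<p. (\<Sum>v\<in>U. L k v * x v)\<^sup>2)"
    using assms(5) by (auto simp: inertia_def upper_inertia_def)
  obtain M where M: "\<And>x. bil A V x x \<le> (\<Sum>k<q. (\<Sum>v\<in>V. M k v * x v)\<^sup>2)"
    using assms(6) by (auto simp: inertia_def upper_inertia_def)
  define N where "N = (\<lambda>i v. if i < p then (if v \<in> U then L i v else 0)
                             else (if v \<in> V then M (i - p) v else 0))"
  have NL: "(\<Sum>v\<in>U \<union> V. N k v * x v) = (\<Sum>v\<in>U. L k v * x v)" if "k < p" for k x
    using that assms(1-3) by (subst sum.union_disjoint) (auto simp: N_def intro!: sum.neutral)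
  have NM: "(\<Sum>v\<in>U \<union> V. N (p + k) v * x v) = (\<Sum>v\<in>V. M k v * x v)" for k x
    using assms(1-3) by (subst sum.union_disjoint) (auto simp: N_def intro!: sum.neutral)
  have "bil A (U \<union> V) x x \<le> (\<Sum>k<p + q. (\<Sum>v\<in>U \<union> V. N k v * x v)\<^sup>2)" for x
  proof -
    have "(\<Sum>k<p + q. (\<Sum>v\<in>U \<union> V. N k v * x v)\<^sup>2)
      = (\<Sum>k<p. (\<Sum>v\<in>U \<union> V. N k v * x v)\<^sup>2) + (\<Sum>k<q. (\<Sum>v\<in>U \<union> V. N (p + k) v * x v)\<^sup>2)"
      by (induction q) (simp_all add: add.assoc)
    then show ?thesis using L[of x] M[of x] by (simp add: bil NL NM)
  qed
  then have "upper_inertia A (U \<union> V) (p + q)"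
    unfolding upper_inertia_def by blast
  with low show ?thesis by (simp add: inertia_def)
qed

lemma inertia_empty: "inertia A {} 0"
  by (simp add: inertia_def lower_inertia_def upper_inertia_def bil_def)

lemma inertia_single: "inertia A {v} (if A v v > 0 then 1 else 0)"
proof (cases "A v v > 0")
  case True
  have "lower_inertia A {v} 1"
    unfolding lower_inertia_def using True
    by (intro exI[of _ "\<lambda>_ _. 1 / sqrt (A v v)"]) (simp add: bil_def field_simps)
  moreover have "upper_inertia A {v} 1"
    unfolding upper_inertia_def using True
    by (intro exI[of _ "\<lambda>_ _. sqrt (A v v)"]) (simp add: bil_def power2_eq_square mult_ac)
  ultimately show ?thesis using True by (simp add: inertia_def)
next
  case False
  then show ?thesis
    by (auto simp: inertia_def lower_inertia_def upper_inertia_def bil_def mult.assoc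
        intro: mult_nonpos_nonneg)
qed

text \<open>Splitting off a hyperbolic plane: \<open>2 (s x\<^sub>u + \<beta>) (s x\<^sub>v + \<alpha>) / s\<close> carries all terms of the
  form that involve the coordinates \<open>x\<^sub>u\<close> and \<open>x\<^sub>v\<close>, and contributes one positive square.\<close>

lemma inertia_hyperbolic:
  assumes "finite V" "u \<in> V" "v \<in> V" "u \<noteq> v"
    and sym: "\<And>i j. i \<in> V \<Longrightarrow> j \<in> V \<Longrightarrow> A i j = A j i"
    and "A u u = 0" "A v v = 0" "A u v \<noteq> 0"
    and "inertia (\<lambda>i j. A i j - (A i u * A v j + A i v * A u j) / A u v) (V - {u, v}) p"
  shows "inertia A V (Suc p)"
proof -
  let ?U = "V - {u, v}" and ?s = "A u v"
  let ?B = "\<lambda>i j. A i j - (A i u * A v j + A i v * A u j) / ?s"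
  define \<alpha> where "\<alpha> x = (\<Sum>j\<in>?U. A u j * x j)" for x
  define \<beta> where "\<beta> x = (\<Sum>j\<in>?U. A v j * x j)" for x
  have V: "V = insert u (insert v ?U)" using assms(2,3) by auto
  have fin: "finite ?U" using assms(1) by simp
  have symU: "A i u = A u i" "A i v = A v i" if "i \<in> ?U" for i
    using that sym assms(2,3) by blast+
  have vu: "A v u = ?s" using sym assms(2,3) by auto
  have B: "bil ?B ?U x y = bil A ?U x y - (\<alpha> x * \<beta> y + \<beta> x * \<alpha> y) / ?s" for x y
  proof -
    have "\<alpha> x * \<beta> y = (\<Sum>i\<in>?U. \<Sum>j\<in>?U. A u i * A v j * x i * y j)" for x y
      unfolding \<alpha>_def \<beta>_def sum_product by (simp add: mult_ac)
    moreover have "\<beta> x * \<alpha> y = (\<Sum>i\<in>?U. \<Sum>j\<in>?U. A v i * A u j * x i * y j)" for x y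
      unfolding \<alpha>_def \<beta>_def sum_product by (simp add: mult_ac)
    moreover have "bil ?B ?U x y = (\<Sum>i\<in>?U. \<Sum>j\<in>?U. A i j * x i * y j
        - (A u i * A v j * x i * y j + A v i * A u j * x i * y j) / ?s)"
      unfolding bil_def
      by (intro sum.cong refl) (simp add: symU algebra_simps add_divide_distrib)
    ultimately show ?thesis
      by (simp add: bil_def sum_subtractf sum.distrib sum_divide_distrib[symmetric])
  qed
  have expand: "bil A V x y = bil ?B ?U x y
    + ((?s * x u + \<beta> x) * (?s * y v + \<alpha> y) + (?s * y u + \<beta> y) * (?s * x v + \<alpha> x)) / ?s" for x y
  proof -
    have row: "(\<Sum>j\<in>V. A i j * x i * y j)
        = A i u * x i * y u + A i v * x i * y v + x i * (\<Sum>j\<in>?U. A i j * y j)" for i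
      by (subst V) (use fin assms(4) in \<open>simp add: sum_distrib_left mult_ac\<close>)
    have "bil A V x y = (\<Sum>i\<in>V. \<Sum>j\<in>V. A i j * x i * y j)" by (simp add: bil_def)
    also have "\<dots> = (\<Sum>j\<in>V. A u j * x u * y j) + (\<Sum>j\<in>V. A v j * x v * y j)
        + (\<Sum>i\<in>?U. \<Sum>j\<in>V. A i j * x i * y j)"
      by (subst (1) V) (use fin assms(4) in simp)
    also have "(\<Sum>i\<in>?U. \<Sum>j\<in>V. A i j * x i * y j) = \<alpha> x * y u + \<beta> x * y v + bil A ?U x y"
      unfolding row
      by (simp add: sum.distrib \<alpha>_def \<beta>_def bil_def sum_distrib_left sum_distrib_right symU mult_ac)
    finally have "bil A V x y = ?s * x u * y v + x u * \<alpha> y + (?s * x v * y u + x v * \<beta> y)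
        + (\<alpha> x * y u + \<beta> x * y v + bil A ?U x y)"
      unfolding row using assms(6,7) by (simp add: vu \<alpha>_def \<beta>_def mult_ac)
    then show ?thesis unfolding B using assms(8) by (simp add: field_simps)
  qed
  obtain X where X: "\<And>i j. i < p \<Longrightarrow> j < p \<Longrightarrow> bil ?B ?U (X i) (X j) = (if i = j then 1 else 0)"
    using assms(9) by (auto simp: inertia_def lower_inertia_def)
  \<comment> \<open>The values at \<open>u\<close> and \<open>v\<close> are chosen so that both
    factors \<open>?s * x u + \<beta> x\<close> and \<open>?s * x v + \<alpha> x\<close> vanish; on
    lifted vectors the form is the Schur complement \<open>?B\<close>.\<close>
  define lift where "lift x = (\<lambda>w. if w = u then - \<beta> x / ?s else if w = v then - \<alpha> x / ?s else x w)" for x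
  \<comment> \<open>The additional orthonormal vector lives on \<open>u\<close> and \<open>v\<close>
    only. Its value is \<open>2 * ?s * (1 / (2 * ?s)) = 1\<close>, and it is orthogonal to all
    lifted vectors because their two factors vanish.\<close>
  define z where "z = (\<lambda>w. if w = u then 1 else if w = v then 1 / (2 * ?s) else 0 :: real)"
  define Z where "Z i = (if i < p then lift (X i) else z)" for i
  have cong: "\<alpha> x = \<alpha> y" "\<beta> x = \<beta> y" if "\<And>w. w \<in> ?U \<Longrightarrow> x w = y w" for x y
    unfolding \<alpha>_def \<beta>_def by (intro sum.cong refl; simp add: that)+
  have lift: "\<alpha> (lift x) = \<alpha> x" "\<beta> (lift x) = \<beta> x" "lift x u = - \<beta> x / ?s" "lift x v = - \<alpha> x / ?s" for x
    using assms(4) by (auto simp: lift_def intro!: cong split: if_splits)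
  have z: "\<alpha> z = 0" "\<beta> z = 0" "z u = 1" "z v = 1 / (2 * ?s)"
    using assms(4) by (auto simp: z_def \<alpha>_def \<beta>_def intro!: sum.neutral)
  have "bil ?B ?U (lift x) (lift y) = bil ?B ?U x y" for x y
    by (rule bil_cong) (auto simp: lift_def)
  then have ll: "bil A V (lift x) (lift y) = bil ?B ?U x y" for x y
    unfolding expand lift using assms(8) by simp
  have zB: "bil ?B ?U z y = 0" "bil ?B ?U y z = 0" for y
    by (auto simp: bil_def z_def intro!: sum.neutral)
  have lz: "bil A V (lift x) z = 0" "bil A V z (lift x) = 0" "bil A V z z = 1" for x
    unfolding expand lift z zB using assms(8) by (simp_all add: field_simps)
  have "\<forall>i<Suc p. \<forall>j<Suc p. bil A V (Z i) (Z j) = (if i = j then 1 else 0)"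
    by (auto simp: Z_def ll lz X less_Suc_eq)
  then have low: "lower_inertia A V (Suc p)" unfolding lower_inertia_def by blast
  obtain L where L: "\<And>x. bil ?B ?U x x \<le> (\<Sum>k<p. (\<Sum>v\<in>?U. L k v * x v)\<^sup>2)"
    using assms(9) by (auto simp: inertia_def upper_inertia_def)
  \<comment> \<open>Form number \<open>p\<close> is \<open>P + Q / ?s\<close> for the two factors
    \<open>P\<close> and \<open>Q\<close> of the hyperbolic part. Its square dominates
    \<open>2 * P * Q / ?s\<close>, the difference being
    \<open>P\<^sup>2 + (Q / ?s)\<^sup>2\<close>.\<close>
  define M where "M k w = (if k < p then (if w \<in> ?U then L k w else 0)
      else if w = u then ?s else if w = v then 1 else A v w + A u w / ?s)" for k w
  have sumV: "(\<Sum>w\<in>V. h w) = h u + h v + (\<Sum>w\<in>?U. h w)" for h :: "'a \<Rightarrow> real"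
    by (subst V) (use fin assms(4) in simp)
  have NL: "(\<Sum>w\<in>V. M k w * x w) = (\<Sum>w\<in>?U. L k w * x w)" if "k < p" for k x
    unfolding sumV using that by (simp add: M_def)
  have Np: "(\<Sum>w\<in>V. M p w * x w) = (?s * x u + \<beta> x) + (?s * x v + \<alpha> x) / ?s" for x
  proof -
    have "(\<Sum>w\<in>?U. M p w * x w) = (\<Sum>w\<in>?U. A v w * x w + A u w * x w / ?s)"
      by (intro sum.cong refl) (auto simp: M_def algebra_simps)
    also have "\<dots> = \<beta> x + \<alpha> x / ?s"
      by (simp add: \<alpha>_def \<beta>_def sum.distrib sum_divide_distrib)
    finally show ?thesis unfolding sumV using assms(4,8) by (simp add: M_def field_simps)
  qed
  have "bil A V x x \<le> (\<Sum>k<Suc p. (\<Sum>w\<in>V. M k w * x w)\<^sup>2)" for x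
  proof -
    have "(P * Q + P * Q) / ?s \<le> (P + Q / ?s)\<^sup>2" for P Q :: real
    proof -
      have "(P + Q / ?s)\<^sup>2 - (P * Q + P * Q) / ?s = P\<^sup>2 + (Q / ?s)\<^sup>2"
        using assms(8) by (simp add: power2_eq_square field_simps)
      then show ?thesis by (smt (verit) zero_le_power2)
    qed
    then show ?thesis
      unfolding expand sum.lessThan_Suc Np using L[of x] by (auto simp: NL intro!: add_mono)
  qed
  then have "upper_inertia A V (Suc p)" unfolding upper_inertia_def by blast
  with low show ?thesis by (simp add: inertia_def)
qed

text \<open>Substituting \<open>H x\<close> for \<open>x\<close> turns one form into the other.
  Since \<open>H\<close> is its own inverse, the same map \<open>T\<close> pulls the orthonormal
  vectors back, so no second matrix has to be carried along.\<close>

lemma inertia_congruence: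
  assumes V: "finite V"
    and A: "\<And>i j. i \<in> V \<Longrightarrow> j \<in> V \<Longrightarrow> A i j = bil B V (\<lambda>k. H k i) (\<lambda>k. H k j)"
    and H: "\<And>i j. i \<in> V \<Longrightarrow> j \<in> V \<Longrightarrow> (\<Sum>k\<in>V. H i k * H k j) = (if i = j then 1 else 0)"
    and "inertia B V p"
  shows "inertia A V p"
proof -
  define T where "T x k = (\<Sum>i\<in>V. x i * H k i)" for x k
  have bil: "bil A V x y = bil B V (T x) (T y)" for x y
    unfolding T_def bil_sum[OF V] by (auto simp: bil_def[of A] A mult_ac intro!: sum.cong)
  have TT: "T (T x) i = x i" if "i \<in> V" for x i
  proof -
    have "T (T x) i = (\<Sum>k\<in>V. \<Sum>j\<in>V. x j * (H i k * H k j))"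
      unfolding T_def sum_distrib_right by (simp add: mult_ac)
    also have "\<dots> = (\<Sum>j\<in>V. \<Sum>k\<in>V. x j * (H i k * H k j))" by (rule sum.swap)
    also have "\<dots> = (\<Sum>j\<in>V. x j * (if i = j then 1 else 0))"
      unfolding sum_distrib_left[symmetric] using that by (intro sum.cong refl) (simp add: H)
    also have "\<dots> = (\<Sum>j\<in>V. if j = i then x j else 0)" by (intro sum.cong refl) auto
    also have "\<dots> = x i" using that V by simp
    finally show ?thesis .
  qed
  obtain X where X: "\<And>i j. i < p \<Longrightarrow> j < p \<Longrightarrow> bil B V (X i) (X j) = (if i = j then 1 else 0)"
    using assms(4) by (auto simp: inertia_def lower_inertia_def)
  have "bil A V (T (X i)) (T (X j)) = bil B V (X i) (X j)" for i j
    unfolding bil by (rule bil_cong) (auto simp: TT)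
  then have low: "lower_inertia A V p"
    unfolding lower_inertia_def using X by (intro exI[of _ "\<lambda>i. T (X i)"]) simp
  obtain L where L: "\<And>x. bil B V x x \<le> (\<Sum>k<p. (\<Sum>v\<in>V. L k v * x v)\<^sup>2)"
    using assms(4) by (auto simp: inertia_def upper_inertia_def)
  have "(\<Sum>v\<in>V. L k v * T x v) = (\<Sum>j\<in>V. (\<Sum>v\<in>V. L k v * H v j) * x j)" for k x
    unfolding T_def sum_distrib_left sum_distrib_right by (subst sum.swap) (simp add: mult_ac)
  then have "bil A V x x \<le> (\<Sum>k<p. (\<Sum>j\<in>V. (\<Sum>v\<in>V. L k v * H v j) * x j)\<^sup>2)" for x
    unfolding bil using L[of "T x"] by simp
  then have "upper_inertia A V p"
    unfolding upper_inertia_def by (intro exI[of _ "\<lambda>k j. \<Sum>v\<in>V. L k v * H v j"]) blast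
  with low show ?thesis by (simp add: inertia_def)
qed

section \<open>Positive eigenvalues of symmetric matrices\<close>

text \<open>The fundamental theorem of algebra yields a complex eigenvector \<open>v\<close> for
  some \<open>a\<close>. By symmetry the Hermitian value \<open>S = a * N\<close> equals its
  conjugate, and \<open>N > 0\<close>, so \<open>a\<close> is real. Real and imaginary parts of
  \<open>v\<close> then both satisfy the eigenvalue equation, and one of them is nonzero.\<close>

lemma symmetric_real_eigenvector:
  fixes A :: "real mat"
  assumes A: "A \<in> carrier_mat n n" and sym: "transpose_mat A = A" and "n > 0"
  obtains e x where "x \<in> carrier_vec n" "x \<bullet> x = 1" "A *\<^sub>v x = e \<cdot>\<^sub>v x"
proof -
  have symA: "A $$ (i, j) = A $$ (j, i)" if "i < n" "j < n" for i j
    using that A sym by (metis carrier_matD index_transpose_mat(1))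
  define C where "C = map_mat complex_of_real A"
  have C: "C \<in> carrier_mat n n" using A by (simp add: C_def)
  obtain a where "poly (char_poly C) a = 0"
    using fundamental_theorem_of_algebra[of "char_poly C"] degree_monic_char_poly[OF C] assms(3)
    by (metis constant_degree not_gr_zero)
  then have "eigenvalue C a" using eigenvalue_root_char_poly[OF C] by simp
  then obtain v where v: "v \<in> carrier_vec n" "v \<noteq> 0\<^sub>v n" "C *\<^sub>v v = a \<cdot>\<^sub>v v"
    using C by (auto simp: eigenvalue_def eigenvector_def)
  have eq: "(\<Sum>j<n. complex_of_real (A $$ (i, j)) * v $ j) = a * v $ i" if "i < n" for i
  proof -
    have "(C *\<^sub>v v) $ i = (\<Sum>j<n. complex_of_real (A $$ (i, j)) * v $ j)"
      using that v(1) A by (simp add: C_def scalar_prod_def atLeast0LessThan)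
    then show ?thesis using that v by simp
  qed
  define S where "S = (\<Sum>i<n. \<Sum>j<n. complex_of_real (A $$ (i, j)) * v $ j * cnj (v $ i))"
  define N where "N = (\<Sum>i<n. (cmod (v $ i))\<^sup>2)"
  have SN: "S = a * complex_of_real N"
    unfolding S_def N_def sum_distrib_right[symmetric]
    by (simp add: eq sum_distrib_left mult.assoc flip: complex_norm_square)
  have "cnj S = (\<Sum>i<n. \<Sum>j<n. complex_of_real (A $$ (i, j)) * v $ i * cnj (v $ j))"
    unfolding S_def by (simp add: mult_ac)
  also have "\<dots> = (\<Sum>j<n. \<Sum>i<n. complex_of_real (A $$ (i, j)) * v $ i * cnj (v $ j))"
    by (rule sum.swap)
  also have "\<dots> = S"
    unfolding S_def by (intro sum.cong refl) (simp add: symA)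
  finally have "cnj a * complex_of_real N = a * complex_of_real N"
    unfolding SN by simp
  moreover have "N \<noteq> 0"
  proof
    assume "N = 0"
    then have "\<forall>i\<in>{..<n}. (cmod (v $ i))\<^sup>2 = 0"
      unfolding N_def by (subst (asm) sum_nonneg_eq_0_iff) auto
    then show False using v(1,2) by (auto simp: vec_eq_iff)
  qed
  ultimately have "cnj a = a" by simp
  then have a: "a = complex_of_real (Re a)" by (simp add: complex_eq_iff)
  have real_ev: "A *\<^sub>v y = Re a \<cdot>\<^sub>v y"
    if y: "y \<in> carrier_vec n" "\<And>i. i < n \<Longrightarrow> (\<Sum>j<n. A $$ (i, j) * y $ j) = Re a * y $ i" for y
    using y A by (intro eq_vecI) (auto simp: scalar_prod_def atLeast0LessThan)
  define r where "r = vec n (\<lambda>i. Re (v $ i))"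
  define s where "s = vec n (\<lambda>i. Im (v $ i))"
  have Re: "A *\<^sub>v r = Re a \<cdot>\<^sub>v r"
  proof (rule real_ev)
    fix i assume i: "i < n"
    have "(\<Sum>j<n. A $$ (i, j) * r $ j) = Re (\<Sum>j<n. complex_of_real (A $$ (i, j)) * v $ j)"
      by (simp add: r_def)
    also have "\<dots> = Re a * r $ i" unfolding eq[OF i] by (subst a) (simp add: r_def i)
    finally show "(\<Sum>j<n. A $$ (i, j) * r $ j) = Re a * r $ i" .
  qed (simp add: r_def)
  have Im: "A *\<^sub>v s = Re a \<cdot>\<^sub>v s"
  proof (rule real_ev)
    fix i assume i: "i < n"
    have "(\<Sum>j<n. A $$ (i, j) * s $ j) = Im (\<Sum>j<n. complex_of_real (A $$ (i, j)) * v $ j)"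
      by (simp add: s_def)
    also have "\<dots> = Re a * s $ i" unfolding eq[OF i] by (subst a) (simp add: s_def i)
    finally show "(\<Sum>j<n. A $$ (i, j) * s $ j) = Re a * s $ i" .
  qed (simp add: s_def)
  have "r \<noteq> 0\<^sub>v n \<or> s \<noteq> 0\<^sub>v n"
    using v(1,2) by (auto simp: r_def s_def vec_eq_iff complex_eq_iff)
  then obtain y where y: "y \<in> carrier_vec n" "y \<noteq> 0\<^sub>v n" "A *\<^sub>v y = Re a \<cdot>\<^sub>v y"
    using Re Im by (metis r_def s_def vec_carrier)
  have pos: "y \<bullet> y > 0"
  proof -
    obtain i where "i < n" "y $ i \<noteq> 0" using y(1,2) by (auto simp: vec_eq_iff)
    then show ?thesis
      using y(1) by (auto simp: scalar_prod_def zero_less_mult_iff linorder_neq_iff intro!: sum_pos2[of _ i])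
  qed
  define x where "x = (1 / sqrt (y \<bullet> y)) \<cdot>\<^sub>v y"
  have "x \<bullet> x = (1 / sqrt (y \<bullet> y)) * (1 / sqrt (y \<bullet> y)) * (y \<bullet> y)"
    using y(1) by (simp add: x_def)
  then have "x \<bullet> x = 1" using pos by simp
  moreover have "A *\<^sub>v x = Re a \<cdot>\<^sub>v x"
    unfolding x_def using y A by (simp add: mult_mat_vec smult_smult_assoc mult.commute)
  moreover have "x \<in> carrier_vec n" using y(1) by (simp add: x_def)
  ultimately show ?thesis using that by blast
qed

text \<open>The reflection in the hyperplane orthogonal to \<open>w = x - e\<^sub>0\<close>.  If \<open>w = 0\<close>, then \<open>2 / N = 0\<close> and
  \<open>H\<close> is the identity.\<close>

lemma householder:
  fixes x :: "real vec"
  assumes x: "x \<in> carrier_vec n" "x \<bullet> x = 1" and n: "n > 0"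
  obtains H where "H \<in> carrier_mat n n" "transpose_mat H = H" "H * H = 1\<^sub>m n" "H *\<^sub>v unit_vec n 0 = x"
proof -
  define w where "w i = x $ i - (if i = 0 then 1 else 0)" for i
  define N where "N = (\<Sum>i<n. w i * w i)"
  define H where "H = mat n n (\<lambda>(i, j). (if i = j then 1 else 0) - 2 / N * (w i * w j))"
  have H: "H \<in> carrier_mat n n" by (simp add: H_def)
  have xx: "(\<Sum>i<n. x $ i * x $ i) = 1"
    using x by (simp add: scalar_prod_def atLeast0LessThan)
  have "N = (\<Sum>i<n. x $ i * x $ i - (if i = 0 then 2 * x $ 0 else 0) + (if i = 0 then 1 else 0))"
    unfolding N_def w_def by (intro sum.cong refl) (simp add: algebra_simps)
  \<comment> \<open>Unit length of \<open>x\<close> collapses \<open>N\<close> to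
    \<open>-2 * w 0\<close>. This is why the reflection takes the first unit vector exactly to
    \<open>x\<close>.\<close>
  then have N: "N = 2 - 2 * x $ 0"
    using n by (simp add: sum.distrib sum_subtractf xx)
  have w0: "w i = 0" if "N = 0" "i < n" for i
  proof -
    have "\<forall>i\<in>{..<n}. w i * w i = 0"
      using that(1) unfolding N_def by (subst (asm) sum_nonneg_eq_0_iff) auto
    then show ?thesis using that(2) by simp
  qed
  have "(H * H) $$ (i, j) = 1\<^sub>m n $$ (i, j)" if ij: "i < n" "j < n" for i j
  proof -
    let ?d = "\<lambda>i j. if i = j then 1 else 0 :: real"
    have "(H * H) $$ (i, j)
        = (\<Sum>k<n. (?d i k - 2 / N * (w i * w k)) * (?d k j - 2 / N * (w k * w j)))"
      using ij by (simp add: H_def scalar_prod_def atLeast0LessThan)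
    also have "\<dots> = (\<Sum>k<n. (if k = i then ?d i j - 2 / N * (w i * w j) else 0)
        - (if k = j then 2 / N * (w i * w j) else 0)
        + 2 / N * 2 / N * (w i * w j) * (w k * w k))"
      by (intro sum.cong refl) (simp add: algebra_simps)
    also have "\<dots> = ?d i j - 2 / N * (w i * w j) - 2 / N * (w i * w j)
        + 2 / N * 2 / N * (w i * w j) * N"
      unfolding sum.distrib sum_subtractf sum_distrib_left[symmetric] N_def[symmetric]
      using ij by simp
    also have "\<dots> = ?d i j" by (cases "N = 0") auto
    finally show ?thesis using ij by simp
  qed
  then have HH: "H * H = 1\<^sub>m n" using H by (intro eq_matI) auto
  have "(H *\<^sub>v unit_vec n 0) $ i = x $ i" if "i < n" for i
  proof -
    have "(H *\<^sub>v unit_vec n 0) $ i = (if i = 0 then 1 else 0) - 2 / N * (w i * w 0)"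
      using that n H by (simp add: H_def)
    also have "\<dots> = x $ i"
    proof (cases "N = 0")
      case True
      then show ?thesis using w0[OF True that] by (simp add: w_def)
    next
      case False
      have "2 / N * w 0 = -1" using False N by (simp add: w_def field_simps)
      then have "2 / N * (w i * w 0) = - w i" by (metis mult.left_commute mult_minus1_right)
      then show ?thesis by (simp add: w_def)
    qed
    finally show ?thesis .
  qed
  then have "H *\<^sub>v unit_vec n 0 = x" using H x by (intro eq_vecI) auto
  moreover have "transpose_mat H = H" by (intro eq_matI) (auto simp: H_def mult_ac)
  ultimately show ?thesis using that H HH by blast
qed

lemma conjugated_mat_index:
  fixes H A :: "real mat"
  assumes "H \<in> carrier_mat n n" "A \<in> carrier_mat n n" "transpose_mat H = H" "i < n" "j < n"
  shows "(H * A * H) $$ (i, j) = bil (\<lambda>i j. A $$ (i, j)) {..<n} (\<lambda>k. H $$ (k, i)) (\<lambda>k. H $$ (k, j))"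
proof -
  have sym: "H $$ (i, k) = H $$ (k, i)" if "k < n" for k
    using that assms by (metis carrier_matD index_transpose_mat(1))
  have "(H * A * H) $$ (i, j) = (\<Sum>k<n. H $$ (i, k) * (\<Sum>l<n. A $$ (k, l) * H $$ (l, j)))"
    using assms by (simp add: scalar_prod_def atLeast0LessThan)
  also have "\<dots> = (\<Sum>k<n. \<Sum>l<n. H $$ (i, k) * (A $$ (k, l) * H $$ (l, j)))"
    unfolding sum_distrib_left ..
  finally show ?thesis by (simp add: bil_def sym mult_ac)
qed

text \<open>Deflation: a reflection that sends the first unit vector to a unit eigenvector
  conjugates \<open>A\<close> into a block matrix with blocks \<open>e\<close> and \<open>D\<close>.
  The first column comes from the eigenvector, the first row from symmetry. The characteristic
  polynomial and the index split along the same blocks, so the list \<open>es\<close> records the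
  eigenvalues with multiplicities for both.\<close>

lemma symmetric_inertia_eigenvalues:
  fixes A :: "real mat"
  assumes "A \<in> carrier_mat n n" "transpose_mat A = A"
  shows "\<exists>es. char_poly A = (\<Prod>e\<leftarrow>es. [:- e, 1:]) \<and>
              inertia (\<lambda>i j. A $$ (i, j)) {..<n} (length (filter (\<lambda>e. 0 < e) es))"
  using assms
proof (induction n arbitrary: A)
  case 0
  then have "degree (char_poly A) = 0" "lead_coeff (char_poly A) = 1"
    using degree_monic_char_poly[of A 0] by auto
  then have "char_poly A = 1" by (auto elim!: degree_eq_zeroE simp: one_pCons)
  then show ?case by (intro exI[of _ "[]"]) (simp add: inertia_empty)
next
  case (Suc m)
  let ?n = "Suc m"
  obtain e x where x: "x \<in> carrier_vec ?n" "x \<bullet> x = 1" "A *\<^sub>v x = e \<cdot>\<^sub>v x"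
    using symmetric_real_eigenvector[OF Suc.prems zero_less_Suc] by blast
  obtain H where H: "H \<in> carrier_mat ?n ?n" "transpose_mat H = H" "H * H = 1\<^sub>m ?n"
      "H *\<^sub>v unit_vec ?n 0 = x"
    using householder[OF x(1,2)] by auto
  note A = Suc.prems(1)
  define B where "B = H * A * H"
  have B: "B \<in> carrier_mat ?n ?n" using A H by (simp add: B_def)
  have "transpose_mat B = B"
    unfolding B_def using A H(1) Suc.prems(2)
    by (simp add: transpose_mult[of _ ?n ?n _ ?n] H(2) assoc_mult_mat[of _ ?n ?n _ ?n _ ?n])
  then have symB: "B $$ (i, j) = B $$ (j, i)" if "i < ?n" "j < ?n" for i j
    using that B by (metis carrier_matD index_transpose_mat(1))
  have HBH: "H * B * H = A"
  proof -
    have "H * B * H = (H * H) * A * (H * H)"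
      unfolding B_def using A H(1) by (simp add: assoc_mult_mat[of _ ?n ?n _ ?n _ ?n])
    then show ?thesis using A H by simp
  qed
  have "B *\<^sub>v unit_vec ?n 0 = H *\<^sub>v (A *\<^sub>v x)"
    unfolding B_def using A H by (simp add: assoc_mult_mat_vec[of _ ?n ?n _ ?n])
  also have "\<dots> = e \<cdot>\<^sub>v (H *\<^sub>v (H *\<^sub>v unit_vec ?n 0))"
    using x H by (simp add: mult_mat_vec)
  also have "\<dots> = e \<cdot>\<^sub>v unit_vec ?n 0"
    using H(1,3) by (simp flip: assoc_mult_mat_vec[of _ ?n ?n _ ?n])
  finally have "B *\<^sub>v unit_vec ?n 0 = e \<cdot>\<^sub>v unit_vec ?n 0" .
  then have col: "B $$ (i, 0) = (if i = 0 then e else 0)" if "i < ?n" for i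
  proof -
    have "(B *\<^sub>v unit_vec ?n 0) $ i = B $$ (i, 0)" using that B by simp
    then show ?thesis using \<open>B *\<^sub>v unit_vec ?n 0 = e \<cdot>\<^sub>v unit_vec ?n 0\<close> that by (auto split: if_splits)
  qed
  define D where "D = mat m m (\<lambda>(i, j). B $$ (Suc i, Suc j))"
  have D: "D \<in> carrier_mat m m" "transpose_mat D = D"
    by (auto simp: D_def symB intro!: eq_matI)
  obtain es where es: "char_poly D = (\<Prod>e\<leftarrow>es. [:- e, 1:])"
      "inertia (\<lambda>i j. D $$ (i, j)) {..<m} (length (filter (\<lambda>e. 0 < e) es))"
    using Suc.IH[OF D] by blast
  have "B = four_block_mat (mat 1 1 (\<lambda>_. e)) (0\<^sub>m 1 m) (0\<^sub>m m 1) D"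
  proof (rule eq_matI)
    fix i j assume "i < dim_row (four_block_mat (mat 1 1 (\<lambda>_. e)) (0\<^sub>m 1 m) (0\<^sub>m m 1) D)"
      "j < dim_col (four_block_mat (mat 1 1 (\<lambda>_. e)) (0\<^sub>m 1 m) (0\<^sub>m m 1) D)"
    then have "i < ?n" "j < ?n" using D by auto
    then show "B $$ (i, j) = four_block_mat (mat 1 1 (\<lambda>_. e)) (0\<^sub>m 1 m) (0\<^sub>m m 1) D $$ (i, j)"
      using D(1) col[of i] col[of j] symB[of i j]
      by (cases i; cases j) (auto simp: D_def)
  qed (use B D in auto)
  then have "char_poly B = char_poly (mat 1 1 (\<lambda>_. e)) * char_poly D"
    using D(1) by (metis char_poly_four_block_zeros_col mat_carrier zero_carrier_mat)
  moreover have "char_poly (mat 1 1 (\<lambda>_. e)) = [:- e, 1:]"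
    by (simp add: char_poly_defs det_single)
  moreover have "similar_mat_wit A B H H"
    using A B H HBH by (intro similar_mat_witI[of _ _ ?n]) auto
  then have "char_poly A = char_poly B"
    by (intro char_poly_similar) (auto simp: similar_mat_def)
  ultimately have cp: "char_poly A = (\<Prod>e\<leftarrow>e # es. [:- e, 1:])"
    using es(1) by simp
  have "inertia (\<lambda>i j. B $$ (i, j)) (Suc ` {..<m}) (length (filter (\<lambda>e. 0 < e) es))"
  proof (rule inertia_reindex)
    show "inertia (\<lambda>i j. B $$ (Suc i, Suc j)) {..<m} (length (filter (\<lambda>e. 0 < e) es))"
      using es(2) by (subst inertia_cong[of _ _ "\<lambda>i j. D $$ (i, j)"]) (auto simp: D_def)
  qed simp
  then have "inertia (\<lambda>i j. B $$ (i, j)) ({0} \<union> Suc ` {..<m})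
      ((if B $$ (0, 0) > 0 then 1 else 0) + length (filter (\<lambda>e. 0 < e) es))"
    using col symB[of 0] by (intro inertia_disjoint_union inertia_single) auto
  moreover have "{0} \<union> Suc ` {..<m} = {..<?n}" by (auto simp: image_iff less_Suc_eq_0_disj)
  ultimately have "inertia (\<lambda>i j. B $$ (i, j)) {..<?n} (length (filter (\<lambda>e. 0 < e) (e # es)))"
    by (simp add: col split: if_splits)
  then have "inertia (\<lambda>i j. A $$ (i, j)) {..<?n} (length (filter (\<lambda>e. 0 < e) (e # es)))"
  proof (rule inertia_congruence[rotated 3, where H = "\<lambda>i j. H $$ (i, j)"])
    fix i j assume "i \<in> {..<?n}" "j \<in> {..<?n}"
    then show "A $$ (i, j) = bil (\<lambda>i j. B $$ (i, j)) {..<?n} (\<lambda>k. H $$ (k, i)) (\<lambda>k. H $$ (k, j))"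
      using conjugated_mat_index[OF H(1) B H(2)] HBH by simp
    have "(H * H) $$ (i, j) = (\<Sum>k<?n. H $$ (i, k) * H $$ (k, j))"
      using H(1) \<open>i \<in> {..<?n}\<close> \<open>j \<in> {..<?n}\<close> by (simp add: scalar_prod_def atLeast0LessThan)
    then show "(\<Sum>k<?n. H $$ (i, k) * H $$ (k, j)) = (if i = j then 1 else 0)"
      using \<open>i \<in> {..<?n}\<close> \<open>j \<in> {..<?n}\<close> H(3) by simp
  qed simp
  with cp show ?case by blast
qed

lemma order_prod_list_linear:
  "order x (\<Prod>e\<leftarrow>es. [:- e, 1:]) = count_list es x" for x :: real
proof (induction es)
  case (Cons e es)
  have nz: "(\<Prod>e\<leftarrow>es. [:- e, 1:]) \<noteq> 0" for es :: "real list"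
    by (auto simp: prod_list_zero_iff)
  have "order x [:- e, 1:] = (if x = e then 1 else 0)"
    using order_power_n_n[of e 1] by (auto intro!: order_0I)
  moreover have "order x ([:- e, 1:] * (\<Prod>e\<leftarrow>es. [:- e, 1:]))
      = order x [:- e, 1:] + order x (\<Prod>e\<leftarrow>es. [:- e, 1:])"
    by (rule order_mult) (use nz[of "e # es"] in \<open>simp only: list.map prod_list.Cons not_False_eq_True\<close>)
  ultimately show ?case unfolding list.map prod_list.Cons using Cons by simp
qed simp

lemma sum_count_list_filter:
  "(\<Sum>x\<in>{x \<in> set es. P x}. count_list es x) = length (filter P es)"
proof -
  have "(\<Sum>x\<in>{x \<in> set es. P x}. count_list es x)
      = (\<Sum>x\<in>set (filter P es). count_list (filter P es) x)"
    by (rule sum.cong) (auto simp: count_list_eq_length_filter intro: arg_cong[where f = length] filter_cong)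
  then show ?thesis by (simp add: sum_count_set)
qed

text \<open>Besides linking multiplicities in the characteristic polynomial to the index, this is
  the existence half of Sylvester's law: every symmetric form on a finite set has some
  \<open>p\<close> with both kinds of witnesses.\<close>

lemma symmetric_inertia_index:
  fixes A :: "'a \<Rightarrow> 'a \<Rightarrow> real"
  assumes V: "finite V" and sym: "\<And>i j. i \<in> V \<Longrightarrow> j \<in> V \<Longrightarrow> A i j = A j i"
    and f: "bij_betw f {..<n} V" 
  defines "M \<equiv> mat n n (\<lambda>(i, j). A (f i) (f j))"
  shows "inertia A V (\<Sum>x\<in>{x. eigenvalue M x \<and> 0 < x}. order x (char_poly M))"
proof -
  have M: "M \<in> carrier_mat n n" by (simp add: M_def)
  have fV: "f i \<in> V" if "i < n" for i using f that by (auto simp: bij_betw_def)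
  have "transpose_mat M = M" unfolding M_def by (intro eq_matI) (auto simp: fV sym)
  then obtain es where es: "char_poly M = (\<Prod>e\<leftarrow>es. [:- e, 1:])"
      "inertia (\<lambda>i j. M $$ (i, j)) {..<n} (length (filter (\<lambda>e. 0 < e) es))"
    using symmetric_inertia_eigenvalues[OF M] by blast
  have "eigenvalue M x \<longleftrightarrow> x \<in> set es" for x
    unfolding eigenvalue_root_char_poly[OF M] es(1)
    by (auto simp: poly_prod_list prod_list_zero_iff)
  then have "(\<Sum>x\<in>{x. eigenvalue M x \<and> 0 < x}. order x (char_poly M))
      = length (filter (\<lambda>e. 0 < e) es)"
    by (simp add: es(1) order_prod_list_linear sum_count_list_filter)
  moreover have "inertia (\<lambda>i j. A (f i) (f j)) {..<n} (length (filter (\<lambda>e. 0 < e) es))"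
    using es(2) by (subst inertia_cong[of _ _ "\<lambda>i j. M $$ (i, j)"]) (auto simp: M_def)
  then have "inertia A (f ` {..<n}) (length (filter (\<lambda>e. 0 < e) es))"
    using f by (intro inertia_reindex) (auto simp: bij_betw_def)
  ultimately show ?thesis using f by (simp add: bij_betw_def)
qed

lemma inertia_pos_inertia:
  assumes "signed_graph \<Gamma>"
  shows "inertia (adj_entry \<Gamma>) (verts \<Gamma>) (pos_inertia \<Gamma>)"
proof -
  have fin: "finite (verts \<Gamma>)" using assms by (simp add: signed_graph_def)
  then have "\<exists>f. bij_betw f {..<card (verts \<Gamma>)} (verts \<Gamma>)"
    using ex_bij_betw_nat_finite[OF fin] by (simp add: atLeast0LessThan)
  then have "bij_betw (SOME f. bij_betw f {..<card (verts \<Gamma>)} (verts \<Gamma>)) {..<card (verts \<Gamma>)} (verts \<Gamma>)"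
    by (rule someI_ex)
  from symmetric_inertia_index[OF fin _ this, of "adj_entry \<Gamma>"] show ?thesis
    by (simp add: pos_inertia_def adj_matrix_def adj_matrix_wrt_def adj_entry_def insert_commute)
qed

section \<open>Graphs as edge weights\<close>

text \<open>Weights of edge sets are symmetric by construction, and induced subgraphs are obtained by
  shrinking the vertex set while keeping \<open>W\<close>.\<close>

definition weighted :: "'a set \<Rightarrow> ('a set \<Rightarrow> real) \<Rightarrow> bool" where
  "weighted V W \<longleftrightarrow> finite V \<and> (\<forall>x\<in>V. W {x} = 0) \<and> (\<forall>x\<in>V. \<forall>y\<in>V. W {x, y} \<in> {-1, 0, 1})"

definition nbs :: "'a set \<Rightarrow> ('a set \<Rightarrow> real) \<Rightarrow> 'a \<Rightarrow> 'a set" where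
  "nbs V W x = {y \<in> V. W {x, y} \<noteq> 0}"

abbreviation deg :: "'a set \<Rightarrow> ('a set \<Rightarrow> real) \<Rightarrow> 'a \<Rightarrow> nat" where
  "deg V W x \<equiv> card (nbs V W x)"

definition edge_set :: "'a set \<Rightarrow> ('a set \<Rightarrow> real) \<Rightarrow> 'a set set" where
  "edge_set V W = {{x, y} | x y. x \<in> V \<and> y \<in> V \<and> W {x, y} \<noteq> 0}"

text \<open>Connectedness is phrased by cuts instead of walks: for a deletion or a contraction, it
  then suffices to extend a given cut to the other graph and to move one crossing edge.\<close>

definition conn :: "'a set \<Rightarrow> ('a set \<Rightarrow> real) \<Rightarrow> bool" where
  "conn V W \<longleftrightarrow> V \<noteq> {} \<and>
     (\<forall>S\<subseteq>V. S \<noteq> {} \<longrightarrow> S \<noteq> V \<longrightarrow> (\<exists>x\<in>S. \<exists>y\<in>V - S. W {x, y} \<noteq> 0))"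

definition pos_index :: "'a set \<Rightarrow> ('a set \<Rightarrow> real) \<Rightarrow> nat" where
  "pos_index V W = (THE p. inertia (\<lambda>x y. W {x, y}) V p)"

lemma weighted_subset: "weighted V W \<Longrightarrow> U \<subseteq> V \<Longrightarrow> weighted U W"
  unfolding weighted_def using finite_subset by blast

lemma weighted_finite: "weighted V W \<Longrightarrow> finite V"
  by (simp add: weighted_def)

lemma finite_nbs [simp]: "finite V \<Longrightarrow> finite (nbs V W x)"
  by (simp add: nbs_def)

lemma pos_index_eqI: "finite V \<Longrightarrow> inertia (\<lambda>x y. W {x, y}) V p \<Longrightarrow> pos_index V W = p"
  unfolding pos_index_def by (rule the_equality) (auto intro: inertia_unique)

lemma inertia_pos_index:
  assumes "finite V"
  shows "inertia (\<lambda>x y. W {x, y}) V (pos_index V W)"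
proof -
  obtain f where "bij_betw f {..<card V} V"
    using ex_bij_betw_nat_finite[OF assms] by (auto simp: atLeast0LessThan)
  from symmetric_inertia_index[OF assms _ this, of "\<lambda>x y. W {x, y}"]
  obtain p where "inertia (\<lambda>x y. W {x, y}) V p" by (auto simp: insert_commute)
  then show ?thesis using pos_index_eqI[OF assms] by metis
qed

lemma pos_index_mono: "finite V \<Longrightarrow> U \<subseteq> V \<Longrightarrow> pos_index U W \<le> pos_index V W"
  using inertia_mono inertia_pos_index finite_subset by metis

lemma pos_index_hyperbolic:
  assumes "weighted V W" "u \<in> V" "v \<in> V" "W {u, v} \<noteq> 0"
    and "inertia (\<lambda>i j. W {i, j} - (W {i, u} * W {v, j} + W {i, v} * W {u, j}) / W {u, v}) (V - {u, v}) p"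
  shows "pos_index V W = Suc p"
proof (rule pos_index_eqI)
  show "finite V" using assms(1) by (simp add: weighted_def)
  show "inertia (\<lambda>x y. W {x, y}) V (Suc p)"
    using assms by (intro inertia_hyperbolic[of V u v]) (auto simp: weighted_def insert_commute)
qed

text \<open>Each correction term of the Schur complement has a factor \<open>W {u, i}\<close> with
  \<open>i\<close> different from the only neighbour of \<open>u\<close>. All of them vanish, so the
  complement is the graph induced on \<open>V - {u, v}\<close>.\<close>

lemma pos_index_pendant:
  assumes "weighted V W" "u \<in> V" "nbs V W u = {v}"
  shows "pos_index V W = Suc (pos_index (V - {u, v}) W)"
proof (rule pos_index_hyperbolic)
  have v: "v \<in> V" "W {u, v} \<noteq> 0" "\<And>x. x \<in> V \<Longrightarrow> x \<noteq> v \<Longrightarrow> W {u, x} = 0"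
    using assms(3) by (auto simp: nbs_def)
  then show "v \<in> V" "W {u, v} \<noteq> 0" by auto
  have "inertia (\<lambda>x y. W {x, y}) (V - {u, v}) (pos_index (V - {u, v}) W)"
    using assms(1) by (intro inertia_pos_index) (simp add: weighted_def)
  then show "inertia (\<lambda>i j. W {i, j} - (W {i, u} * W {v, j} + W {i, v} * W {u, j}) / W {u, v})
      (V - {u, v}) (pos_index (V - {u, v}) W)"
    by (subst inertia_cong[where B = "\<lambda>x y. W {x, y}"]) (auto simp: v(3) insert_commute[of _ u])
qed (use assms in auto)

lemma pos_index_pos:
  assumes "weighted V W" "u \<in> V" "v \<in> V" "W {u, v} \<noteq> 0"
  shows "pos_index V W > 0"
proof -
  have w: "weighted {u, v} W" using assms by (auto intro: weighted_subset)
  have "pos_index {u, v} W = Suc (pos_index ({u, v} - {u, v}) W)"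
    using w assms by (intro pos_index_pendant) (auto simp: nbs_def weighted_def)
  then show ?thesis using pos_index_mono[of V "{u, v}" W] assms by (simp add: weighted_def)
qed

lemma nbs_remove:
  "nbs V W x = nbs (V - {v}) W x \<union> (if v \<in> V \<and> W {x, v} \<noteq> 0 then {v} else {})"
  by (auto simp: nbs_def)

lemma deg_remove:
  assumes "finite V" "v \<in> V"
  shows "deg V W x = deg (V - {v}) W x + (if W {x, v} \<noteq> 0 then 1 else 0)"
  unfolding nbs_remove[of V W x v] using assms by (auto simp: nbs_def)

lemma edge_set_remove:
  assumes "weighted V W" "v \<in> V"
  shows "edge_set V W = edge_set (V - {v}) W \<union> (\<lambda>x. {v, x}) ` nbs V W v"
    "edge_set (V - {v}) W \<inter> (\<lambda>x. {v, x}) ` nbs V W v = {}"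
proof -
  have Wv: "W {v} = 0" using assms by (simp add: weighted_def)
  show "edge_set V W = edge_set (V - {v}) W \<union> (\<lambda>x. {v, x}) ` nbs V W v"
  proof (intro equalityI subsetI)
    fix e assume "e \<in> edge_set V W"
    then obtain x y where e: "e = {x, y}" "x \<in> V" "y \<in> V" "W {x, y} \<noteq> 0"
      unfolding edge_set_def by blast
    consider "x = v" | "y = v" | "x \<noteq> v" "y \<noteq> v" by blast
    then show "e \<in> edge_set (V - {v}) W \<union> (\<lambda>x. {v, x}) ` nbs V W v"
    proof cases
      case 1
      then show ?thesis using e by (auto simp: nbs_def)
    next
      case 2
      then have "e = {v, x}" "x \<in> nbs V W v" using e by (auto simp: nbs_def insert_commute)
      then show ?thesis by blast
    next
      case 3
      then show ?thesis using e unfolding edge_set_def by blast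
    qed
  next
    fix e assume "e \<in> edge_set (V - {v}) W \<union> (\<lambda>x. {v, x}) ` nbs V W v"
    then show "e \<in> edge_set V W" using assms(2) unfolding edge_set_def nbs_def by blast
  qed
  have "v \<notin> e" if "e \<in> edge_set (V - {v}) W" for e using that unfolding edge_set_def by blast
  then show "edge_set (V - {v}) W \<inter> (\<lambda>x. {v, x}) ` nbs V W v = {}" by blast
qed

lemma finite_edge_set: "finite V \<Longrightarrow> finite (edge_set V W)"
  by (rule finite_subset[of _ "Pow V"]) (auto simp: edge_set_def)

lemma inj_doubleton: "inj_on (\<lambda>x. {v, x}) A"
  by (auto simp: inj_on_def doubleton_eq_iff)

lemma handshake:
  assumes "weighted V W"
  shows "(\<Sum>x\<in>V. deg V W x) = 2 * card (edge_set V W)"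
proof -
  have "finite V" using assms by (simp add: weighted_def)
  then show ?thesis using assms
  proof (induction V rule: finite_induct)
    case empty
    show ?case by (simp add: edge_set_def)
  next
    case (insert v V)
    let ?V = "insert v V"
    have V: "?V - {v} = V" using insert.hyps by simp
    have w: "weighted V W" using insert.prems by (auto intro: weighted_subset)
    have Wv: "W {v} = 0" using insert.prems by (simp add: weighted_def)
    have "(\<Sum>x\<in>?V. deg ?V W x) = deg ?V W v + (\<Sum>x\<in>V. deg ?V W x)"
      using insert.hyps by simp
    also have "(\<Sum>x\<in>V. deg ?V W x) = (\<Sum>x\<in>V. deg V W x + (if W {x, v} \<noteq> 0 then 1 else 0))"
      using insert.hyps(1) deg_remove[of ?V v W] unfolding V by (intro sum.cong refl) blast
    also have "\<dots> = (\<Sum>x\<in>V. deg V W x) + card {x\<in>V. W {x, v} \<noteq> 0}"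
      using insert.hyps(1) by (simp add: sum.distrib sum.If_cases Int_def)
    also have "{x\<in>V. W {x, v} \<noteq> 0} = nbs ?V W v"
      using insert.hyps Wv by (auto simp: nbs_def insert_commute)
    also have "(\<Sum>x\<in>V. deg V W x) = 2 * card (edge_set V W)"
      using insert.IH[OF w] .
    also have "card (edge_set ?V W) = card (edge_set V W) + deg ?V W v"
      using edge_set_remove[OF insert.prems, of v] insert.hyps(1) unfolding V
      by (simp add: card_Un_disjoint finite_edge_set card_image inj_doubleton)
    ultimately show ?case by simp
  qed
qed

section \<open>The excess of a connected graph\<close>

definition phi :: "nat \<Rightarrow> int" where
  "phi d = int d - 3 + (if d = 1 then 1 else 0)"

text \<open>The difference is what a vertex pays back when it loses an edge. It vanishes exactly at
  degree \<open>2\<close>, where the term for pendant vertices comes into play.\<close>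

lemma phi_diff: "d > 0 \<Longrightarrow> phi d - phi (d - 1) = (if d = 1 then 2 else if d = 2 then 0 else 1)"
  by (auto simp: phi_def)

lemma sum_phi_remove:
  assumes "weighted V W" "v \<in> V"
  shows "(\<Sum>x\<in>V. phi (deg V W x)) = phi (deg V W v) + (\<Sum>x\<in>V - {v}. phi (deg (V - {v}) W x))
    + (\<Sum>x\<in>nbs V W v. phi (deg V W x) - phi (deg V W x - 1))"
proof -
  have fin: "finite V" and Wv: "W {v} = 0" using assms by (auto simp: weighted_def)
  have nb: "nbs V W v \<subseteq> V - {v}" using Wv by (auto simp: nbs_def)
  have "(\<Sum>x\<in>V. phi (deg V W x)) = phi (deg V W v) + (\<Sum>x\<in>V - {v}. phi (deg V W x))"
    by (rule sum.remove[OF fin assms(2)])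
  also have "(\<Sum>x\<in>V - {v}. phi (deg V W x)) = (\<Sum>x\<in>V - {v}. phi (deg (V - {v}) W x)
      + (if x \<in> nbs V W v then phi (deg V W x) - phi (deg V W x - 1) else 0))"
  proof (intro sum.cong refl)
    fix x assume "x \<in> V - {v}"
    then show "phi (deg V W x) = phi (deg (V - {v}) W x)
      + (if x \<in> nbs V W v then phi (deg V W x) - phi (deg V W x - 1) else 0)"
      using deg_remove[OF fin assms(2), of W x] by (auto simp: nbs_def insert_commute)
  qed
  also have "\<dots> = (\<Sum>x\<in>V - {v}. phi (deg (V - {v}) W x))
      + (\<Sum>x\<in>nbs V W v. phi (deg V W x) - phi (deg V W x - 1))"
    using fin nb by (simp add: sum.distrib sum.If_cases Int_absorb1)
  finally show ?thesis by simp
qed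

definition excess :: "'a set \<Rightarrow> ('a set \<Rightarrow> real) \<Rightarrow> int" where
  "excess V W = 2 * int (pos_index V W) + 2 + (\<Sum>x\<in>V. phi (deg V W x))"

text \<open>Only monotonicity of the index enters, hence an inequality. Neighbours of degree at
  least \<open>3\<close> are credited with \<open>1\<close> each; the repayment of all others is
  estimated by \<open>0\<close>.\<close>

lemma excess_remove:
  assumes "weighted V W" "v \<in> V"
  shows "excess V W \<ge> excess (V - {v}) W + phi (deg V W v) + int (card {x \<in> nbs V W v. deg V W x \<ge> 3})"
proof -
  have fin: "finite V" using assms by (simp add: weighted_def)
  have "int (card {x \<in> nbs V W v. deg V W x \<ge> 3}) = (\<Sum>x\<in>nbs V W v. if deg V W x \<ge> 3 then 1 else 0)"
    using fin by (simp add: sum.If_cases Int_def)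
  also have "\<dots> \<le> (\<Sum>x\<in>nbs V W v. phi (deg V W x) - phi (deg V W x - 1))"
  proof (rule sum_mono)
    fix x assume "x \<in> nbs V W v"
    then have "v \<in> nbs V W x" using assms(2) by (auto simp: nbs_def insert_commute)
    then have "deg V W x > 0" using fin by (auto simp: card_gt_0_iff)
    then show "(if deg V W x \<ge> 3 then 1 else 0) \<le> phi (deg V W x) - phi (deg V W x - 1)"
      using phi_diff[of "deg V W x"] by (auto split: if_splits)
  qed
  finally show ?thesis
    using pos_index_mono[OF fin, of "V - {v}" W]
    by (simp add: excess_def sum_phi_remove[OF assms])
qed

section \<open>Connectedness by cuts, and vertices whose deletion preserves it\<close>

lemma connD:
  assumes "conn V W" "S \<subseteq> V" "S \<noteq> {}" "S \<noteq> V"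
  obtains x y where "x \<in> S" "y \<in> V" "y \<notin> S" "W {x, y} \<noteq> 0"
  using assms unfolding conn_def by blast

lemma conn_closed:
  assumes "conn V W" "S \<subseteq> V" "S \<noteq> {}" "\<And>x. x \<in> S \<Longrightarrow> nbs V W x \<subseteq> S"
  shows "V = S"
proof (rule ccontr)
  assume "V \<noteq> S"
  then obtain x y where "x \<in> S" "y \<in> V" "y \<notin> S" "W {x, y} \<noteq> 0"
    using connD[OF assms(1-3)] by metis
  then show False using assms(4)[of x] by (auto simp: nbs_def)
qed

lemma conn_single: "conn {x} W"
  by (auto simp: conn_def)

lemma conn_insert:
  assumes "conn S W" "s \<in> S" "W {s, x} \<noteq> 0"
  shows "conn (insert x S) W"
proof (cases "x \<in> S")
  case True
  then show ?thesis using assms(1) by (simp add: insert_absorb)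
next
  case False
  have "\<exists>a\<in>T. \<exists>b\<in>insert x S - T. W {a, b} \<noteq> 0"
    if T: "T \<subseteq> insert x S" "T \<noteq> {}" "T \<noteq> insert x S" for T
  proof -
    consider "T \<inter> S = {}" | "T \<inter> S = S" | "T \<inter> S \<noteq> {}" "T \<inter> S \<noteq> S" by blast
    then show ?thesis
    proof cases
      case 1
      then have "T = {x}" using T by blast
      then show ?thesis using assms(2,3) False by (auto simp: insert_commute)
    next
      case 2
      then have "T = S" using T by blast
      then show ?thesis using assms(2,3) False by auto
    next
      case 3
      then obtain a b where "a \<in> T \<inter> S" "b \<in> S" "b \<notin> T \<inter> S" "W {a, b} \<noteq> 0"
        using connD[OF assms(1), of "T \<inter> S"] by blast
      then show ?thesis by blast
    qed
  qed
  then show ?thesis unfolding conn_def by blast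
qed

text \<open>A connected set is grown from \<open>r\<close> along crossing edges, one vertex at a
  time, until a single vertex is missing. That vertex is a leaf of the spanning tree traced by this
  process.\<close>

lemma ex_noncut:
  assumes "conn V W" "finite V" "r \<in> V" "card V \<ge> 2"
  obtains v where "v \<in> V" "v \<noteq> r" "conn (V - {v}) W"
proof -
  have "\<exists>S\<subseteq>V. r \<in> S \<and> conn S W \<and> card S = Suc k" if "Suc k \<le> card V" for k
    using that
  proof (induction k)
    case 0
    show ?case using assms(3) by (intro exI[of _ "{r}"]) (simp add: conn_single)
  next
    case (Suc k)
    then obtain S where S: "S \<subseteq> V" "r \<in> S" "conn S W" "card S = Suc k" by auto
    then have "S \<noteq> V" using Suc.prems by auto
    then obtain x y where xy: "x \<in> S" "y \<in> V" "y \<notin> S" "W {x, y} \<noteq> 0"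
      using connD[OF assms(1) S(1)] S(2) by blast
    then have "conn (insert y S) W" using conn_insert[OF S(3)] by blast
    moreover have "card (insert y S) = Suc (Suc k)"
      using S xy finite_subset[OF S(1) assms(2)] by simp
    ultimately show ?case using S xy by (intro exI[of _ "insert y S"]) auto
  qed
  moreover have "Suc (card V - 2) = card V - 1" using assms(4) by simp
  ultimately obtain S where S: "S \<subseteq> V" "r \<in> S" "conn S W" "card S = card V - 1"
    by (metis diff_le_self)
  have "card (V - S) = 1"
    using S assms(2,4) finite_subset[OF S(1)] by (simp add: card_Diff_subset)
  then obtain v where v: "V - S = {v}" by (auto simp: card_1_singleton_iff)
  then have "V - {v} = S" "v \<in> V" "v \<noteq> r" using S by blast+
  then show ?thesis using that S(3) by blast
qed

lemma conn_deg_pos: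
  assumes "conn V W" "finite V" "card V \<ge> 2" "x \<in> V"
  shows "deg V W x > 0"
proof -
  have "{x} \<noteq> V" using assms(3) by auto
  then obtain a b where "a \<in> {x}" "b \<in> V" "W {a, b} \<noteq> 0"
    using connD[OF assms(1), of "{x}"] assms(4) by blast
  then show ?thesis using assms(2) by (auto simp: nbs_def card_gt_0_iff)
qed

text \<open>A cut of \<open>V - {u}\<close> is extended to \<open>V\<close> by placing
  \<open>u\<close> on the side of its only neighbour \<open>v\<close>. The crossing edge then cannot
  end in \<open>u\<close>.\<close>

lemma conn_remove_pendant:
  assumes "conn V W" "nbs V W u = {v}" "u \<noteq> v"
  shows "conn (V - {u}) W"
proof -
  have v: "v \<in> V" "W {u, v} \<noteq> 0" "\<And>x. x \<in> V \<Longrightarrow> W {u, x} \<noteq> 0 \<Longrightarrow> x = v"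
    using assms(2) by (auto simp: nbs_def)
  have "\<exists>x\<in>S. \<exists>y\<in>V - {u} - S. W {x, y} \<noteq> 0" if S: "S \<subseteq> V - {u}" "S \<noteq> {}" "S \<noteq> V - {u}" for S
  proof (cases "v \<in> S \<and> u \<in> V")
    case True
    have "insert u S \<subseteq> V" "insert u S \<noteq> {}" "insert u S \<noteq> V" using S True by auto
    then obtain x y where "x \<in> insert u S" "y \<in> V" "y \<notin> insert u S" "W {x, y} \<noteq> 0"
      using connD[OF assms(1)] by blast
    then show ?thesis using v(3) True by (metis DiffI insertE singletonD insertI1 insertI2)
  next
    case False
    have "S \<noteq> V" using S(1,3) by (cases "u \<in> V") auto
    then have "S \<subseteq> V" "S \<noteq> {}" "S \<noteq> V" using S by blast+
    then obtain x y where "x \<in> S" "y \<in> V" "y \<notin> S" "W {x, y} \<noteq> 0"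
      using connD[OF assms(1)] by blast
    moreover have "y \<noteq> u"
      using v(3)[of x] False S calculation by (auto simp: insert_commute[of u])
    ultimately show ?thesis by blast
  qed
  then show ?thesis using v(1) assms(3) unfolding conn_def by blast
qed

text \<open>A connected 2-regular graph is a cycle, and the product of its weights is its sign. The
  last condition joins both residues: sign \<open>+\<close> with order \<open>0\<close> modulo
  \<open>4\<close>, sign \<open>-\<close> with order \<open>2\<close> modulo
  \<open>4\<close>.\<close>

definition extremal :: "'a set \<Rightarrow> ('a set \<Rightarrow> real) \<Rightarrow> bool" where
  "extremal V W \<longleftrightarrow> (\<forall>x\<in>V. deg V W x = 2) \<and> even (card V)
      \<and> (\<Prod>e\<in>edge_set V W. W e) = (-1) ^ (card V div 2)"

lemma deg_2_nbs:
  assumes "deg V W x = 2" "b \<in> nbs V W x"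
  obtains a where "nbs V W x = {a, b}" "a \<noteq> b"
proof -
  obtain c d where cd: "nbs V W x = {c, d}" "c \<noteq> d" using assms(1) by (auto simp: card_2_iff)
  then consider "b = d" | "b = c" using assms(2) by blast
  then show ?thesis
  proof cases
    case 1
    then show ?thesis using cd that by blast
  next
    case 2
    then show ?thesis using cd that[of d] by (simp add: insert_commute)
  qed
qed

text \<open>If \<open>S\<close> were a union of components of \<open>V - {v}\<close> meeting exactly one of the two edges at
  \<open>v\<close>, its degree sum would be odd.\<close>

lemma conn_remove_2_regular:
  assumes w: "weighted V W" and "conn V W" and reg: "\<And>x. x \<in> V \<Longrightarrow> deg V W x = 2" and v: "v \<in> V"
  shows "conn (V - {v}) W"
proof -
  have fin: "finite V" and Wv: "W {v} = 0" using w v by (auto simp: weighted_def)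
  have nb: "nbs V W v \<subseteq> V - {v}" using Wv by (auto simp: nbs_def)
  have "nbs V W v \<noteq> {}" using reg[OF v] by auto
  have ex: "\<exists>x\<in>S. x \<in> nbs V W v"
    if S: "S \<subseteq> V - {v}" "S \<noteq> {}" "\<And>x y. x \<in> S \<Longrightarrow> y \<in> V - {v} - S \<Longrightarrow> W {x, y} = 0" for S
  proof -
    have "S \<subseteq> V" "S \<noteq> V" using S(1) v by auto
    then obtain x y where "x \<in> S" "y \<in> V" "y \<notin> S" "W {x, y} \<noteq> 0"
      using connD[OF assms(2) _ S(2)] by blast
    then have "x \<in> nbs V W v" using S(1) S(3)[of x y] by (auto simp: nbs_def insert_commute[of v])
    then show ?thesis using \<open>x \<in> S\<close> by blast
  qed
  have "\<exists>x\<in>S. \<exists>y\<in>V - {v} - S. W {x, y} \<noteq> 0" if S: "S \<subseteq> V - {v}" "S \<noteq> {}" "S \<noteq> V - {v}" for S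
  proof (rule ccontr)
    assume "\<not> ?thesis"
    then have none: "\<And>x y. x \<in> S \<Longrightarrow> y \<in> V - {v} - S \<Longrightarrow> W {x, y} = 0" by blast
    obtain a where a: "a \<in> S" "a \<in> nbs V W v" using ex[OF S(1,2) none] by blast
    have "W {x, y} = 0" if "x \<in> V - {v} - S" "y \<in> V - {v} - (V - {v} - S)" for x y
    proof -
      have "W {y, x} = 0" using none that by blast
      then show ?thesis by (simp add: insert_commute)
    qed
    moreover have "V - {v} - S \<subseteq> V - {v}" "V - {v} - S \<noteq> {}" using S(1,3) by blast+
    ultimately obtain b where b: "b \<in> V - {v} - S" "b \<in> nbs V W v"
      using ex[of "V - {v} - S"] by blast
    obtain c where c: "nbs V W v = {c, b}" using deg_2_nbs[OF reg[OF v] b(2)] by metis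
    then have nbv: "nbs V W v \<inter> S = {a}" using a b by auto
    have finS: "finite S" using S(1) fin finite_subset by blast
    have deg: "deg S W x + (if x = a then 1 else 0) = 2" if "x \<in> S" for x
    proof -
      have "nbs V W x = nbs S W x \<union> (if x = a then {v} else {})"
      proof -
        have "y \<in> S" if "y \<in> V" "y \<noteq> v" "W {x, y} \<noteq> 0" for y
          using none[OF \<open>x \<in> S\<close>] that by blast
        moreover have "W {x, v} \<noteq> 0 \<longleftrightarrow> x = a"
          using nbv \<open>x \<in> S\<close> S(1) by (auto simp: nbs_def insert_commute)
        ultimately show ?thesis using S(1) v by (auto simp: nbs_def)
      qed
      moreover have "v \<notin> nbs S W x" "finite (nbs S W x)"
        using S(1) finS by (auto simp: nbs_def)
      ultimately show ?thesis using reg[of x] that S(1) by (auto split: if_splits)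
    qed
    have "(\<Sum>x\<in>S. deg S W x + (if x = a then 1 else 0)) = (\<Sum>x\<in>S. 2)"
      by (rule sum.cong) (simp_all add: deg)
    then have "(\<Sum>x\<in>S. deg S W x) + 1 = 2 * card S"
      using a(1) finS by (simp add: sum.distrib)
    moreover have "(\<Sum>x\<in>S. deg S W x) = 2 * card (edge_set S W)"
      using handshake weighted_subset[OF w] S(1) by blast
    ultimately have "2 * card (edge_set S W) + 1 = 2 * card S" by simp
    then show False by presburger
  qed
  moreover have "V - {v} \<noteq> {}" using nb \<open>nbs V W v \<noteq> {}\<close> by blast
  ultimately show ?thesis unfolding conn_def by blast
qed

text \<open>Bound and equality case form one induction statement, so that any vertex of degree other
  than \<open>2\<close> in a smaller graph already improves the bound there to
  \<open>1\<close>.\<close>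

definition excess_bound :: "'a set \<Rightarrow> ('a set \<Rightarrow> real) \<Rightarrow> bool" where
  "excess_bound V W \<longleftrightarrow> 0 \<le> excess V W \<and> (excess V W = 0 \<longleftrightarrow> extremal V W)"

section \<open>The steps of the induction for the excess bound\<close>

lemma not_nbs:
  assumes "y \<in> V" "y \<notin> nbs V W x"
  shows "W {x, y} = 0" "W {y, x} = 0"
  using assms by (simp_all add: nbs_def insert_commute[of y x])

lemma excess_pos_if_irregular:
  assumes "excess_bound V W" "x \<in> V" "deg V W x \<noteq> 2"
  shows "excess V W \<ge> 1"
proof -
  have "\<not> extremal V W" using assms(2,3) by (auto simp: extremal_def)
  then show ?thesis using assms(1) by (auto simp: excess_bound_def)
qed

text \<open>Deleting \<open>u\<close> with its neighbour \<open>v\<close> changes the index by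
  exactly \<open>1\<close>, but may disconnect the graph once \<open>v\<close> has degree at least
  \<open>3\<close>. In that case only \<open>u\<close> is deleted, which is enough unless the rest
  is an extremal cycle. Then removing \<open>v\<close> as well leaves a connected graph after all,
  and the exact formula applies.\<close>

lemma excess_pendant:
  assumes w: "weighted V W" and conn: "conn V W" and card: "card V \<ge> 2"
    and u: "u \<in> V" "deg V W u = 1"
    and IH: "\<And>U. U \<subset> V \<Longrightarrow> conn U W \<Longrightarrow> card U \<ge> 2 \<Longrightarrow> excess_bound U W"
  shows "excess V W \<ge> 1"
proof -
  have fin: "finite V" using w by (rule weighted_finite)
  obtain v where nu: "nbs V W u = {v}" using u(2) by (auto simp: card_1_singleton_iff)
  then have v: "v \<in> V" "W {u, v} \<noteq> 0" by (auto simp: nbs_def)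
  then have uv: "u \<noteq> v" using w by (auto simp: weighted_def)
  have unv: "u \<in> nbs V W v" using u v by (auto simp: nbs_def insert_commute)
  define U where "U = V - {u}"
  define K where "K = V - {u, v}"
  have K: "K = U - {v}" by (auto simp: K_def U_def)
  have wU: "weighted U W" and wK: "weighted K W"
    using w by (auto intro: weighted_subset simp: U_def K_def)
  have vU: "v \<in> U" using v uv by (simp add: U_def)
  have finU: "finite U" and finK: "finite K" using wU wK by (simp_all add: weighted_finite)
  have connU: "conn U W" unfolding U_def by (rule conn_remove_pendant[OF conn nu uv])
  have pos_index: "pos_index V W = Suc (pos_index K W)"
    unfolding K_def by (rule pos_index_pendant[OF w u(1) nu])
  have degv: "deg V W v = Suc (deg U W v)"
    using deg_remove[OF fin u(1), of W v] unv by (simp add: U_def nbs_def)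
  have sumV: "(\<Sum>x\<in>V. phi (deg V W x))
      = phi 1 + (\<Sum>x\<in>U. phi (deg U W x)) + (phi (deg V W v) - phi (deg V W v - 1))"
    using sum_phi_remove[OF w u(1)] u(2) by (simp add: nu U_def)
  have sumU: "(\<Sum>x\<in>U. phi (deg U W x)) = phi (deg U W v) + (\<Sum>x\<in>K. phi (deg K W x))
      + (\<Sum>x\<in>nbs U W v. phi (deg U W x) - phi (deg U W x - 1))"
    using sum_phi_remove[OF wU vU] by (simp add: K)
  have nbU: "nbs U W v \<subseteq> K" using wU vU by (auto simp: nbs_def K weighted_def)
  consider "deg V W v = 1" | "deg V W v = 2" | "deg V W v \<ge> 3"
    using degv by linarith
  then show ?thesis
  proof cases
    case 1
    then have "nbs V W v = {u}" using unv by (auto simp: card_1_singleton_iff)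
    then have "V = {u, v}" using conn_closed[OF conn, of "{u, v}"] nu u v by auto
    then have "(\<Sum>x\<in>V. phi (deg V W x)) = phi 1 + phi 1" using uv u(2) 1 by simp
    then show ?thesis unfolding excess_def pos_index by (simp add: phi_def)
  next
    case 2
    then have "deg U W v = 1" using degv by simp
    then obtain t where nv: "nbs U W v = {t}" by (auto simp: card_1_singleton_iff)
    then have t: "t \<in> K" "W {v, t} \<noteq> 0" using nbU by (auto simp: nbs_def)
    have tv: "v \<noteq> t" using t(1) by (auto simp: K)
    have connK: "conn K W" unfolding K by (rule conn_remove_pendant[OF connU nv tv])
    have degt: "deg U W t = Suc (deg K W t)"
      using deg_remove[OF finU vU, of W t] t by (simp add: K insert_commute)
    have ex: "excess V W = excess K W + (phi (deg U W t) - phi (deg U W t - 1))"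
      unfolding excess_def pos_index sumV sumU nv using 2 \<open>deg U W v = 1\<close> by (simp add: phi_def)
    show ?thesis
    proof (cases "card K \<ge> 2")
      case True
      have "K \<subset> V" using u by (auto simp: K_def)
      then have bound: "excess_bound K W" using IH connK True by blast
      have "deg K W t > 0" by (rule conn_deg_pos[OF connK finK True t(1)])
      moreover have "excess K W \<ge> 1" if "deg K W t = 1"
        using excess_pos_if_irregular[OF bound t(1)] that by simp
      moreover have "excess K W \<ge> 0" using bound by (simp add: excess_bound_def)
      ultimately show ?thesis unfolding ex degt by (auto simp: phi_def)
    next
      case False
      then have "card K = 1" using t(1) finK
          by (metis One_nat_def Suc_1 Suc_leI card_gt_0_iff empty_iff le_antisym not_less_eq_eq)
      then have "K = {t}" using t(1) by (auto simp: card_1_singleton_iff)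
      \<comment> \<open>A single vertex lies outside the induction hypothesis, and its excess may be
        \<open>2 - 3 = -1\<close>. The repayment \<open>phi 1 - phi 0 = 2\<close> lifts the total to
        at least \<open>1\<close>.\<close>
      moreover have "nbs {t} W t = {}" using wK \<open>K = {t}\<close> by (auto simp: nbs_def weighted_def)
      ultimately show ?thesis unfolding ex degt by (simp add: excess_def phi_def)
    qed
  next
    case 3
    have "card (nbs U W v) \<le> card U" using finU by (intro card_mono) (auto simp: nbs_def)
    then have cardU: "card U \<ge> 2" using 3 degv by simp
    moreover have "U \<subset> V" using u by (auto simp: U_def)
    ultimately have bound: "excess_bound U W" using IH connU by blast
    have "{x \<in> nbs V W u. deg V W x \<ge> 3} = {v}" using 3 nu by auto
    \<comment> \<open>The cost \<open>phi 1 = -1\<close> of the pendant vertex is cancelled by the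
      credit of \<open>1\<close> for \<open>v\<close>.\<close>
    then have le: "excess V W \<ge> excess U W"
      using excess_remove[OF w u(1)] u(2) by (simp add: U_def phi_def)
    show ?thesis
    proof (cases "extremal U W")
      case False
      then show ?thesis using le bound by (auto simp: excess_bound_def)
    next
      case True
      then have reg: "\<And>x. x \<in> U \<Longrightarrow> deg U W x = 2" by (simp add: extremal_def)
      have connK: "conn K W" unfolding K by (rule conn_remove_2_regular[OF wU connU reg vU])
      have nb2: "card (nbs U W v) = 2" using reg vU by simp
      then have "card K \<ge> 2" using card_mono[OF finK nbU] by simp
      moreover have "K \<subset> V" using u by (auto simp: K_def)
      ultimately have bound: "excess_bound K W" using IH connK by blast
      \<comment> \<open>A neighbour \<open>t\<close> of \<open>v\<close> on the cycle becomes an end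
        of the path \<open>K\<close>. Its degree there is \<open>1\<close>, so \<open>K\<close> is
        not extremal and its excess is at least \<open>1\<close>.\<close>
      obtain t where t: "t \<in> nbs U W v" using nb2 by fastforce
      then have tK: "t \<in> K" using nbU by blast
      have "deg U W t = Suc (deg K W t)"
        using deg_remove[OF finU vU, of W t] t by (simp add: K insert_commute nbs_def)
      moreover have "deg U W t = 2" using reg tK by (simp add: K)
      ultimately have K1: "excess K W \<ge> 1" using excess_pos_if_irregular[OF bound tK] by simp
      have "(\<Sum>x\<in>nbs U W v. phi (deg U W x) - phi (deg U W x - 1)) = (\<Sum>x\<in>nbs U W v. 0)"
        by (rule sum.cong) (use nbU reg in \<open>auto simp: K phi_def\<close>)
      then have "excess V W = excess K W + 1"
        unfolding excess_def pos_index sumV sumU using degv nb2 by (simp add: phi_def)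
      then show ?thesis using K1 by simp
    qed
  qed
qed

text \<open>By \<open>big\<close>, the cost of \<open>v\<close> is covered by its own degree or by
  the credit of a neighbour, which suffices unless \<open>V - {v}\<close> is extremal. In the
  extremal case every neighbour of \<open>v\<close> has degree \<open>2 + 1\<close>, so all of them
  repay, and with \<open>d\<close> the degree of \<open>v\<close> the gain is
  \<open>phi d + d = 2 * d - 3\<close>, at least \<open>1\<close>.\<close>

lemma excess_noncut:
  assumes w: "weighted V W" and deg2: "\<And>x. x \<in> V \<Longrightarrow> deg V W x \<ge> 2"
    and v: "v \<in> V" "conn (V - {v}) W"
    and IH: "\<And>U. U \<subset> V \<Longrightarrow> conn U W \<Longrightarrow> card U \<ge> 2 \<Longrightarrow> excess_bound U W"
    and big: "deg V W v \<ge> 3 \<or> (\<exists>x\<in>nbs V W v. deg V W x \<ge> 3)"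
  shows "excess V W \<ge> 1"
proof -
  let ?U = "V - {v}" and ?c = "card {x \<in> nbs V W v. deg V W x \<ge> 3}"
  have fin: "finite V" using w by (rule weighted_finite)
  have nb: "nbs V W v \<subseteq> ?U" using w v by (auto simp: nbs_def weighted_def)
  have "card ?U \<ge> 2" using card_mono[OF _ nb] fin deg2[OF v(1)] by simp
  moreover have "?U \<subset> V" using v by auto
  ultimately have bound: "excess_bound ?U W" using IH v by blast
  have le: "excess V W \<ge> excess ?U W + phi (deg V W v) + int ?c"
    by (rule excess_remove[OF w v(1)])
  show ?thesis
  proof (cases "extremal ?U W")
    case False
    then have "excess ?U W \<ge> 1" using bound by (auto simp: excess_bound_def)
    moreover have "phi (deg V W v) + int ?c \<ge> 0"
    proof (cases "deg V W v \<ge> 3")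
      case True
      then show ?thesis by (simp add: phi_def)
    next
      case False
      then have "{x \<in> nbs V W v. deg V W x \<ge> 3} \<noteq> {}" using big by auto
      then have "?c > 0" using fin by (simp add: card_gt_0_iff)
      then show ?thesis using deg2[OF v(1)] by (simp add: phi_def)
    qed
    ultimately show ?thesis using le by linarith
  next
    case True
    have "deg V W x = 3" if "x \<in> nbs V W v" for x
      using deg_remove[OF fin v(1), of W x] that nb True
      by (auto simp: nbs_def extremal_def insert_commute)
    then have "{x \<in> nbs V W v. deg V W x \<ge> 3} = nbs V W v" by auto
    moreover have "phi (deg V W v) + int (deg V W v) \<ge> 1"
      using deg2[OF v(1)] by (simp add: phi_def)
    moreover have "excess ?U W \<ge> 0" using bound by (simp add: excess_bound_def)
    ultimately show ?thesis using le by simp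
  qed
qed

text \<open>Contracting \<open>a - u - v - b\<close> to an edge \<open>a - b\<close> of weight
  \<open>- W {a, u} * W {u, v} * W {v, b}\<close> is the effect of splitting off the hyperbolic plane of
  \<open>u\<close> and \<open>v\<close>.\<close>

lemma contract_path:
  assumes w: "weighted V W" and conn: "conn V W" and uv: "u \<in> V" "v \<in> V"
    and nu: "nbs V W u = {a, v}" "a \<noteq> v" and nv: "nbs V W v = {u, b}" "b \<noteq> u"
    and ab: "a \<noteq> b" "W {a, b} = 0"
  defines "W' \<equiv> W({a, b} := - (W {a, u} * W {u, v} * W {v, b}))" and "U \<equiv> V - {u, v}"
  shows "weighted U W'" "conn U W'" "excess V W = excess U W'" "extremal V W \<longleftrightarrow> extremal U W'"
    "card V = card U + 2"
proof -
  have fin: "finite V" using w by (rule weighted_finite)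
  have W0: "\<And>x. x \<in> V \<Longrightarrow> W {x} = 0" using w by (simp add: weighted_def)
  have wt: "W {x, y} = -1 \<or> W {x, y} = 0 \<or> W {x, y} = 1" if "x \<in> V" "y \<in> V" for x y
    using w that unfolding weighted_def by blast
  have aV: "a \<in> V" "W {a, u} \<noteq> 0" and vV: "W {u, v} \<noteq> 0" and bV: "b \<in> V" "W {v, b} \<noteq> 0"
    using nu nv by (auto simp: nbs_def insert_commute)
  have ne: "u \<noteq> v" "a \<noteq> u" "b \<noteq> v" using W0 uv aV bV vV by auto
  have mem: "a \<in> U" "b \<in> U" using aV bV ne nu nv by (auto simp: U_def)
  have zu: "W {x, u} = 0" "W {u, x} = 0" if "x \<in> V" "x \<noteq> a" "x \<noteq> v" for x
    using not_nbs[of x V W u] nu(1) that by simp_all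
  have zv: "W {x, v} = 0" "W {v, x} = 0" if "x \<in> V" "x \<noteq> b" "x \<noteq> u" for x
    using not_nbs[of x V W v] nv(1) that by simp_all
  have unit: "W {a, u} = 1 \<or> W {a, u} = -1" "W {u, v} = 1 \<or> W {u, v} = -1"
      "W {v, b} = 1 \<or> W {v, b} = -1"
    using wt aV bV vV uv by blast+
  \<comment> \<open>The Schur complement divides by \<open>W {u, v}\<close>. A sign is its own
    inverse, so the quotient becomes this product.\<close>
  define s where "s = - (W {a, u} * W {u, v} * W {v, b})"
  have s: "s = 1 \<or> s = -1" using unit unfolding s_def by auto
  have W': "W' e = (if e = {a, b} then s else W e)" for e by (simp add: W'_def s_def)
  have W'ab: "W' {a, b} = s" "W' {b, a} = s" by (simp_all add: W' insert_commute)
  have W'eq: "W' {x, y} = W {x, y}" if "{x, y} \<noteq> {a, b}" for x y using that by (simp add: W')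
  have UV: "U \<subseteq> V" by (auto simp: U_def)
  show card: "card V = card U + 2"
  proof -
    have "card {u, v} = 2" using ne by simp
    then show ?thesis using card_Diff_subset[of "{u, v}" V] card_mono[OF fin, of "{u, v}"] uv
      by (simp add: U_def)
  qed
  show w': "weighted U W'"
  proof -
    have "W' {x} = 0" if "x \<in> U" for x
      using W0[of x] that UV ab(1) by (auto simp: W' doubleton_eq_iff singleton_insert_inj_eq')
    moreover have "W' {x, y} \<in> {-1, 0, 1}" if "x \<in> U" "y \<in> U" for x y
      using wt[of x y] that UV s by (auto simp: W')
    ultimately show ?thesis using fin UV by (auto simp: weighted_def intro: finite_subset)
  qed
  have deg: "deg U W' x = deg V W x" if x: "x \<in> U" for x
  proof -
    consider "x = a" | "x = b" | "x \<noteq> a" "x \<noteq> b" by blast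
    then show ?thesis
    proof cases
      case 1
      have eq: "nbs U W' a = insert b (nbs V W a - {u})"
      proof (rule Set.set_eqI)
        fix y
        show "y \<in> nbs U W' a \<longleftrightarrow> y \<in> insert b (nbs V W a - {u})"
          using s mem W'ab W'eq[of a y] zv[of a] aV ab(1) ne
          by (cases "y = b"; cases "y = v") (auto simp: nbs_def U_def doubleton_eq_iff)
      qed
      have "u \<in> nbs V W a" "b \<notin> nbs V W a" using aV uv ab by (auto simp: nbs_def)
      then show ?thesis unfolding 1 eq using fin
        by (metis Diff_iff card_insert_disjoint card_Suc_Diff1 finite_Diff finite_nbs)
    next
      case 2
      have eq: "nbs U W' b = insert a (nbs V W b - {v})"
      proof (rule Set.set_eqI)
        fix y
        show "y \<in> nbs U W' b \<longleftrightarrow> y \<in> insert a (nbs V W b - {v})"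
          using s mem W'ab W'eq[of b y] zu[of b] bV ab(1) ne
          by (cases "y = a"; cases "y = u") (auto simp: nbs_def U_def doubleton_eq_iff)
      qed
      have "v \<in> nbs V W b" "a \<notin> nbs V W b"
        using bV uv ab by (auto simp: nbs_def insert_commute)
      then show ?thesis unfolding 2 eq using fin
        by (metis Diff_iff card_insert_disjoint card_Suc_Diff1 finite_Diff finite_nbs)
    next
      case 3
      have "W' {x, y} = W {x, y}" for y using 3 by (intro W'eq) (auto simp: doubleton_eq_iff)
      then have "nbs U W' x = nbs V W x"
        using zu[of x] zv[of x] x 3 by (auto simp: nbs_def U_def)
      then show ?thesis by simp
    qed
  qed
  have pos_index: "pos_index V W = Suc (pos_index U W')"
  proof (rule pos_index_hyperbolic[OF w uv vV])
    have "W {i, j} - (W {i, u} * W {v, j} + W {i, v} * W {u, j}) / W {u, v} = W' {i, j}"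
      if ij: "i \<in> U" "j \<in> U" for i j
    proof -
      have ij': "i \<in> V" "j \<in> V" "i \<noteq> u" "i \<noteq> v" "j \<noteq> u" "j \<noteq> v"
        using ij by (auto simp: U_def)
      consider "i = a" "j = b" | "i = b" "j = a" | "{i, j} \<noteq> {a, b}"
        by (metis doubleton_eq_iff)
      then show ?thesis
      proof cases
        case 1
        then show ?thesis
          using W'ab(1) ab(2) zv[of a] aV ab(1) ne unit(2) by (auto simp: s_def)
      next
        case 2
        then show ?thesis
          using W'ab(2) ab zu[of b] bV ne unit(2) nv(2) nu(2)
          by (auto simp: s_def insert_commute[of b a] insert_commute[of b v] insert_commute[of u a])
      next
        case 3
        then have z: "W {i, u} * W {v, j} = 0" "W {i, v} * W {u, j} = 0"
          using zu[OF ij'(1)] zv[OF ij'(2)] zv[OF ij'(1)] zu[OF ij'(2)] ij'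
          by (auto simp: doubleton_eq_iff)
        show ?thesis unfolding z W'eq[OF 3] by simp
      qed
    qed
    then have "inertia (\<lambda>i j. W {i, j} - (W {i, u} * W {v, j} + W {i, v} * W {u, j}) / W {u, v})
        U (pos_index U W')
        = inertia (\<lambda>x y. W' {x, y}) U (pos_index U W')"
      by (rule inertia_cong)
    then show "inertia (\<lambda>i j. W {i, j} - (W {i, u} * W {v, j} + W {i, v} * W {u, j}) / W {u, v})
        (V - {u, v}) (pos_index U W')"
      unfolding U_def[symmetric] using inertia_pos_index[OF weighted_finite[OF w']] by simp
  qed
  have degu: "deg V W u = 2" "deg V W v = 2" using nu nv by auto
  have V: "V = insert u (insert v U)" using uv by (auto simp: U_def)
  have sumV: "(\<Sum>x\<in>V. h x) = h u + (h v + (\<Sum>x\<in>U. h x))" for h :: "'a \<Rightarrow> int"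
    using fin ne by (subst V) (simp add: U_def)
  show "excess V W = excess U W'"
    unfolding excess_def pos_index sumV degu by (simp add: deg phi_def)
  show "conn U W'"
  proof -
    have "\<exists>x\<in>S. \<exists>y\<in>U - S. W' {x, y} \<noteq> 0" if S: "S \<subseteq> U" "S \<noteq> {}" "S \<noteq> U" for S
    proof -
      \<comment> \<open>A cut that separates \<open>a\<close> from \<open>b\<close> is crossed by
        the new edge. Otherwise \<open>u\<close> and \<open>v\<close> join the side containing both,
        and an edge crossing that cut of \<open>V\<close> avoids them.\<close>
      consider "a \<in> S" "b \<notin> S" | "a \<notin> S" "b \<in> S" | "a \<in> S" "b \<in> S" | "a \<notin> S" "b \<notin> S" by blast
      then show ?thesis
      proof cases
        case 1
        then show ?thesis using mem W'ab s by (intro bexI[of _ a] bexI[of _ b]) auto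
      next
        case 2
        then show ?thesis using mem W'ab s by (intro bexI[of _ b] bexI[of _ a]) auto
      next
        case 3
        let ?T = "insert u (insert v S)"
        have "?T \<subseteq> V" "?T \<noteq> {}" "?T \<noteq> V" using S uv by (auto simp: U_def)
        then obtain x y where xy: "x \<in> ?T" "y \<in> V" "y \<notin> ?T" "W {x, y} \<noteq> 0"
          using connD[OF conn] by blast
        have "x \<noteq> u" "x \<noteq> v" using zu(2)[of y] zv(2)[of y] xy 3 by auto
        then have "x \<in> S" "y \<in> U - S" using xy by (auto simp: U_def)
        moreover have "W' {x, y} \<noteq> 0" using xy s by (auto simp: W')
        ultimately show ?thesis by blast
      next
        case 4
        have "S \<subseteq> V" "S \<noteq> V" using S UV uv by (auto simp: U_def)
        then obtain x y where xy: "x \<in> S" "y \<in> V" "y \<notin> S" "W {x, y} \<noteq> 0"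
          using connD[OF conn] S(2) by blast
        have "y \<noteq> u" "y \<noteq> v" using zu(1)[of x] zv(1)[of x] xy 4 S by (auto simp: U_def)
        then have "y \<in> U - S" using xy by (auto simp: U_def)
        moreover have "W' {x, y} \<noteq> 0" using xy s by (auto simp: W')
        ultimately show ?thesis using xy by blast
      qed
    qed
    then show ?thesis using mem unfolding conn_def by blast
  qed
  have edge_set': "edge_set U W' = insert {a, b} (edge_set U W)"
  proof (rule Set.set_eqI)
    fix e
    have "s \<noteq> 0" using s by auto
    then have "{a, b} \<in> edge_set U W'" using mem W'ab(1) unfolding edge_set_def by blast
    then show "e \<in> edge_set U W' \<longleftrightarrow> e \<in> insert {a, b} (edge_set U W)"
      by (cases "e = {a, b}") (auto simp: edge_set_def W')
  qed
  have ab_notin: "{a, b} \<notin> edge_set U W" using ab by (auto simp: edge_set_def)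
  have finU: "finite (edge_set U W)" using fin UV by (auto intro: finite_edge_set finite_subset)
  have "(\<Prod>e\<in>edge_set U W'. W' e) = s * (\<Prod>e\<in>edge_set U W. W' e)"
    unfolding edge_set' using finU ab_notin by (simp add: W')
  also have "(\<Prod>e\<in>edge_set U W. W' e) = (\<Prod>e\<in>edge_set U W. W e)"
    using ab_notin by (intro prod.cong) (auto simp: W')
  finally have prodU: "(\<Prod>e\<in>edge_set U W'. W' e) = s * (\<Prod>e\<in>edge_set U W. W e)" .
  have prod_remove: "(\<Prod>e\<in>edge_set X W. W e) = (\<Prod>e\<in>edge_set (X - {x}) W. W e) * (\<Prod>y\<in>nbs X W x. W {x, y})"
    if "weighted X W" "x \<in> X" for X x
    using edge_set_remove[OF that] weighted_finite[OF that(1)]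
    by (simp add: prod.union_disjoint finite_edge_set prod.reindex[OF inj_doubleton])
  have "nbs (V - {u}) W v = {b}" using nv ne by (auto simp: nbs_def)
  moreover have "V - {u} - {v} = U" by (auto simp: U_def)
  ultimately have "(\<Prod>e\<in>edge_set (V - {u}) W. W e) = (\<Prod>e\<in>edge_set U W. W e) * W {v, b}"
    using prod_remove[of "V - {u}" v] weighted_subset[OF w, of "V - {u}"] uv ne by simp
  then have "(\<Prod>e\<in>edge_set V W. W e) = (\<Prod>e\<in>edge_set U W. W e) * W {v, b} * (W {u, a} * W {u, v})"
    using prod_remove[OF w uv(1)] nu by simp
  \<comment> \<open>The three weights on the path multiply to \<open>- s\<close>. The minus sign
    matches the factor \<open>-1\<close> that the extremality condition gains when half the order
    grows by one.\<close>
  then have prod: "(\<Prod>e\<in>edge_set V W. W e) = - (\<Prod>e\<in>edge_set U W'. W' e)"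
    unfolding prodU s_def by (simp add: insert_commute mult_ac)
  have "(\<forall>x\<in>V. P x) \<longleftrightarrow> P u \<and> P v \<and> (\<forall>x\<in>U. P x)" for P
    using uv by (auto simp: U_def)
  then have "(\<forall>x\<in>V. deg V W x = 2) \<longleftrightarrow> (\<forall>x\<in>U. deg U W' x = 2)"
    using degu by (simp add: deg)
  then show "extremal V W \<longleftrightarrow> extremal U W'"
    unfolding extremal_def prod card by simp
qed

section \<open>Triangles, quadrangles and the induction itself\<close>

lemma edge_set_nbs: "edge_set V W = (\<Union>x\<in>V. (\<lambda>y. {x, y}) ` nbs V W x)"
  by (auto simp: edge_set_def nbs_def)

lemma inertia_zero_pair:
  assumes "a \<noteq> b" "B a a = 0" "B b b = 0" "B a b = B b a"
  shows "inertia B {a, b} (if B a b = 0 then 0 else 1)"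
proof (cases "B a b = 0")
  case True
  have "inertia B ({a} \<union> {b}) ((if B a a > 0 then 1 else 0) + (if B b b > 0 then 1 else 0))"
    using assms True by (intro inertia_disjoint_union inertia_single) auto
  then show ?thesis using assms True by (simp add: insert_commute)
next
  case False
  have "inertia B {a, b} (Suc 0)"
    using assms False by (intro inertia_hyperbolic[of "{a, b}" a b]) (auto simp: inertia_empty)
  then show ?thesis using False by simp
qed

text \<open>Splitting off the plane of \<open>u\<close> and \<open>v\<close> leaves a form on
  \<open>{a, b}\<close> with zero diagonal, because \<open>a\<close>, \<open>v\<close> and also
  \<open>u\<close>, \<open>b\<close> are not adjacent. Its other entry vanishes exactly if the four
  signs multiply to \<open>1\<close>; otherwise the index grows by another \<open>1\<close>. The
  excess is accordingly \<open>0\<close> or \<open>2\<close>.\<close>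

lemma excess_square:
  assumes w: "weighted V W" and V: "V = {a, u, v, b}" and dist: "a \<noteq> v" "u \<noteq> b" "a \<noteq> b"
    and adj: "W {a, u} \<noteq> 0" "W {u, v} \<noteq> 0" "W {v, b} \<noteq> 0" "W {a, b} \<noteq> 0"
    and nadj: "W {a, v} = 0" "W {u, b} = 0"
  shows "excess_bound V W"
proof -
  have W0: "\<And>x. x \<in> V \<Longrightarrow> W {x} = 0" using w by (simp add: weighted_def)
  have ne: "a \<noteq> u" "u \<noteq> v" "v \<noteq> b" using W0 adj V by auto
  have unit: "W {x, y} = 1 \<or> W {x, y} = -1" if "x \<in> V" "y \<in> V" "W {x, y} \<noteq> 0" for x y
    using w that unfolding weighted_def by blast
  have units: "W {a, u} = 1 \<or> W {a, u} = -1" "W {u, v} = 1 \<or> W {u, v} = -1"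
    "W {v, b} = 1 \<or> W {v, b} = -1" "W {a, b} = 1 \<or> W {a, b} = -1"
    using unit adj V by auto
  have nbs: "nbs V W a = {u, b}" "nbs V W u = {a, v}" "nbs V W v = {u, b}" "nbs V W b = {v, a}"
  proof -
    have "W {u, a} \<noteq> 0" "W {v, u} \<noteq> 0" "W {b, v} \<noteq> 0" "W {b, a} \<noteq> 0" "W {v, a} = 0" "W {b, u} = 0"
      using adj nadj by (simp_all add: insert_commute)
    moreover have "W {a} = 0" "W {u} = 0" "W {v} = 0" "W {b} = 0" using W0 V by auto
    ultimately show "nbs V W a = {u, b}" "nbs V W u = {a, v}" "nbs V W v = {u, b}" "nbs V W b = {v, a}"
      using adj nadj unfolding V nbs_def by auto
  qed
  have deg: "\<forall>x\<in>V. deg V W x = 2" using nbs dist ne by (auto simp: V)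
  have card: "card V = 4" using dist ne by (simp add: V)
  define B where "B i j = W {i, j} - (W {i, u} * W {v, j} + W {i, v} * W {u, j}) / W {u, v}" for i j
  have Vd: "V - {u, v} = {a, b}" using dist ne by (auto simp: V)
  have Bab: "B a b = W {a, b} - W {a, u} * W {v, b} / W {u, v}" "B b a = B a b"
    using nadj by (auto simp: B_def insert_commute)
  have "inertia B {a, b} (if B a b = 0 then 0 else 1)"
    using dist nadj W0 V by (intro inertia_zero_pair) (auto simp: Bab(2) B_def insert_commute)
  then have "pos_index V W = Suc (if B a b = 0 then 0 else 1)"
    unfolding B_def Vd[symmetric] by (intro pos_index_hyperbolic[OF w _ _ adj(2)]) (auto simp: V)
  moreover have "(\<Sum>x\<in>V. phi (deg V W x)) = (\<Sum>x\<in>V. -1)"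
    using deg by (intro sum.cong) (auto simp: phi_def)
  ultimately have ex: "excess V W = (if B a b = 0 then 0 else 2)"
    unfolding excess_def using card by auto
  have edge_set: "edge_set V W = {{a, u}, {u, v}, {v, b}, {a, b}}"
  proof -
    have "(\<Union>x\<in>V. f x) = f a \<union> f u \<union> f v \<union> f b" for f :: "'a \<Rightarrow> 'a set set"
      by (auto simp: V)
    then show ?thesis unfolding edge_set_nbs by (simp add: nbs) (auto simp: doubleton_eq_iff)
  qed
  have "(\<Prod>e\<in>edge_set V W. W e) = W {a, u} * W {u, v} * W {v, b} * W {a, b}"
    unfolding edge_set using dist ne by (simp add: doubleton_eq_iff)
  then have "extremal V W \<longleftrightarrow> W {a, u} * W {u, v} * W {v, b} * W {a, b} = 1"
    unfolding extremal_def using deg card by simp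
  also have "\<dots> \<longleftrightarrow> B a b = 0" unfolding Bab using units by auto
  finally show ?thesis unfolding excess_bound_def ex by auto
qed

text \<open>Odd order rules out extremality, so a strict bound is all that is asked for. One edge
  makes the index positive, and \<open>2 + 2 - 3 = 1\<close>.\<close>

lemma excess_triangle:
  assumes w: "weighted V W" and V: "V = {u, v, b}" "card V = 3"
    and deg: "\<And>x. x \<in> V \<Longrightarrow> deg V W x = 2" and "W {u, v} \<noteq> 0"
  shows "excess_bound V W"
proof -
  have "pos_index V W > 0" using pos_index_pos[OF w, of u v] V assms(5) by simp
  moreover have "(\<Sum>x\<in>V. phi (deg V W x)) = (\<Sum>x\<in>V. -1)"
    using deg by (intro sum.cong) (auto simp: phi_def)
  moreover have "\<not> extremal V W" using V(2) by (simp add: extremal_def)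
  ultimately show ?thesis unfolding excess_bound_def excess_def using V(2) by auto
qed

theorem excess_bound:
  assumes "weighted V W" "conn V W" "card V \<ge> 2"
  shows "excess_bound V W"
  using assms
\<comment> \<open>Deletions keep \<open>W\<close>, but a contraction changes it; the weights are
  therefore generalised too.\<close>
proof (induction "card V" arbitrary: V W rule: less_induct)
  case less
  note w = less.prems(1) and conn = less.prems(2) and card = less.prems(3)
  have fin: "finite V" using w by (rule weighted_finite)
  have W0: "\<And>x. x \<in> V \<Longrightarrow> W {x} = 0" using w by (simp add: weighted_def)
  have IH: "excess_bound U W" if "U \<subset> V" "conn U W" "card U \<ge> 2" for U
    using less.hyps[OF psubset_card_mono[OF fin that(1)] weighted_subset[OF w]] that by blast
  have irregular: "excess_bound V W" if "x \<in> V" "deg V W x \<noteq> 2" "excess V W \<ge> 1" for x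
    using that by (auto simp: excess_bound_def extremal_def)
  have pos: "deg V W x > 0" if "x \<in> V" for x
    by (rule conn_deg_pos[OF conn fin card that])
  show ?case
  proof (cases "\<exists>u\<in>V. deg V W u = 1")
    case True
    then obtain u where u: "u \<in> V" "deg V W u = 1" by blast
    then show ?thesis using excess_pendant[OF w conn card u IH] irregular[of u] by simp
  next
    case False
    then have deg2: "deg V W x \<ge> 2" if "x \<in> V" for x
      using pos[OF that] that by (metis One_nat_def Suc_1 Suc_leI le_antisym not_less_eq_eq)
    have noncut: "excess_bound V W"
      if v: "v \<in> V" "conn (V - {v}) W" "x = v \<or> x \<in> nbs V W v" "deg V W x \<ge> 3" for v x
    proof -
      have "excess V W \<ge> 1" using excess_noncut[OF w deg2 v(1,2) IH] v(3,4) by blast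
      moreover have "x \<in> V" using v by (auto simp: nbs_def)
      ultimately show ?thesis using irregular[of x] v(4) by simp
    qed
    obtain r where "r \<in> V" using card by fastforce
    then obtain u where u: "u \<in> V" "conn (V - {u}) W" using ex_noncut[OF conn fin _ card] by metis
    show ?thesis
    proof (cases "\<exists>x\<in>insert u (nbs V W u). deg V W x \<ge> 3")
      case True
      then show ?thesis using noncut[OF u] by blast
    next
      case False
      have degu: "deg V W x = 2" if "x = u \<or> x \<in> nbs V W u" for x
      proof -
        have "x \<in> V" using that u by (auto simp: nbs_def)
        then show ?thesis using deg2[of x] False that by force
      qed
      obtain v where v0: "v \<in> nbs V W u" using degu[of u] by fastforce
      then have v: "v \<in> V" "W {u, v} \<noteq> 0" by (auto simp: nbs_def)
      then have uv: "u \<noteq> v" using W0 u by auto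
      obtain a where nu: "nbs V W u = {a, v}" "a \<noteq> v" using deg_2_nbs[OF _ v0] degu by blast
      have a: "a \<in> V" "W {u, a} \<noteq> 0" using nu by (auto simp: nbs_def)
      then have au: "a \<noteq> u" using W0 u by auto
      have "u \<in> nbs V W v" using u v by (auto simp: nbs_def insert_commute)
      then obtain b where nv: "nbs V W v = {b, u}" "b \<noteq> u"
        using deg_2_nbs[of V W v u] degu[of v] v0 by blast
      have b: "b \<in> V" "W {v, b} \<noteq> 0" using nv by (auto simp: nbs_def)
      then have bv: "b \<noteq> v" using W0 v by auto
      \<comment> \<open>Contraction would create a loop if \<open>a = b\<close>, and would add to an
        existing weight if \<open>a\<close> and \<open>b\<close> are adjacent, possibly leaving the
        range of signs. Both situations are settled directly.\<close>
      consider "a = b" | "a \<noteq> b" "W {a, b} \<noteq> 0" | "a \<noteq> b" "W {a, b} = 0" by blast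
      then show ?thesis
      proof cases
        case 1
        have dega: "deg V W a = 2" using degu nu by blast
        have "{u, v} \<subseteq> nbs V W a" using a u v b 1 by (auto simp: nbs_def insert_commute)
        then have "nbs V W a = {u, v}"
          using dega uv fin by (metis card_2_iff card_subset_eq finite_nbs)
        then have V: "V = {u, v, b}"
          using conn_closed[OF conn, of "{u, v, b}"] nu nv u v b 1 by auto
        then have "card V = 3" using uv nv(2) bv by auto
        then show ?thesis
          using excess_triangle[OF w V _ _ v(2)] V degu nu nv v0 1 by auto
      next
        case 2
        have na: "{u, b} \<subseteq> nbs V W a" and nb: "{v, a} \<subseteq> nbs V W b"
          using a b u v 2 by (auto simp: nbs_def insert_commute)
        have "deg V W a = 2" using degu nu by blast
        then have nbsa: "nbs V W a = {u, b}"
          using na nv(2) fin by (metis card_2_iff card_subset_eq finite_nbs)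
        show ?thesis
        proof (cases "deg V W b \<ge> 3")
          case False
          then have "deg V W b = 2" using deg2[OF b(1)] by simp
          then have nbsb: "nbs V W b = {v, a}"
            using nb nu(2) fin by (metis card_2_iff card_subset_eq finite_nbs)
          have V: "V = {a, u, v, b}"
            using conn_closed[OF conn, of "{a, u, v, b}"] nu nv nbsa nbsb u v a b by auto
          have "W {a, v} = 0" "W {u, b} = 0"
            using nbsa nu v b nu(2) nv(2) uv bv 2 by (auto simp: nbs_def)
          then show ?thesis
            using excess_square[OF w V nu(2) _ 2(1)] a v b 2 nv(2)
            by (auto simp: insert_commute)
        next
          case True
          \<comment> \<open>The vertex \<open>b\<close> of degree at least \<open>3\<close> is a
            neighbour of \<open>v\<close> but not of \<open>u\<close>, so \<open>v\<close> is the
            vertex to delete. It is not a cut vertex, because its neighbours \<open>u\<close> and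
            \<open>b\<close> remain joined through \<open>a\<close>.\<close>
          have "conn (V - {v}) W"
          proof -
            have "\<exists>x\<in>S. \<exists>y\<in>V - {v} - S. W {x, y} \<noteq> 0"
              if S: "S \<subseteq> V - {v}" "S \<noteq> {}" "S \<noteq> V - {v}" for S
            proof -
              have path: "a \<in> V - {v}" "b \<in> V - {v}" "u \<in> V - {v}" "W {a, u} \<noteq> 0" "W {u, a} \<noteq> 0"
                "W {a, b} \<noteq> 0" "W {b, a} \<noteq> 0"
                using a b u 2 nu bv uv by (auto simp: insert_commute)
              \<comment> \<open>A cut through the path \<open>u - a - b\<close> is crossed by one of
                its edges. In the other cases \<open>u\<close> and \<open>b\<close> lie on one side,
                and \<open>v\<close> can be added to that side without creating a crossing
                edge.\<close>
              consider "a \<in> S \<longleftrightarrow> u \<notin> S" | "a \<in> S \<longleftrightarrow> b \<notin> S"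
                | "u \<in> S" "b \<in> S" | "u \<notin> S" "b \<notin> S" by blast
              then show ?thesis
              proof cases
                case 1
                then show ?thesis using path by (cases "a \<in> S") blast+
              next
                case 2
                then show ?thesis using path by (cases "a \<in> S") blast+
              next
                case 3
                have "insert v S \<subseteq> V" "insert v S \<noteq> {}" "insert v S \<noteq> V" using S v by auto
                then obtain x y where xy: "x \<in> insert v S" "y \<in> V" "y \<notin> insert v S" "W {x, y} \<noteq> 0"
                  using connD[OF conn] by blast
                have "y \<notin> nbs V W v" using nv xy 3 by auto
                then have "x \<noteq> v" using xy by (auto simp: nbs_def)
                then show ?thesis using xy by blast
              next
                case 4
                have "S \<subseteq> V" "S \<noteq> V" using S v by auto
                then obtain x y where xy: "x \<in> S" "y \<in> V" "y \<notin> S" "W {x, y} \<noteq> 0"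
                  using connD[OF conn] S(2) by blast
                have "x \<notin> nbs V W v" using nv xy 4 by auto
                then have "y \<noteq> v" using xy \<open>S \<subseteq> V\<close> by (auto simp: nbs_def insert_commute)
                then show ?thesis using xy by blast
              qed
            qed
            then show ?thesis using u uv unfolding conn_def by blast
          qed
          then show ?thesis using noncut[OF v(1)] True nv by blast
        qed
      next
        case 3
        let ?W' = "W({a, b} := - (W {a, u} * W {u, v} * W {v, b}))" and ?U = "V - {u, v}"
        have nv': "nbs V W v = {u, b}" using nv by auto
        note c = contract_path[OF w conn u(1) v(1) nu nv' nv(2) 3]
        have "{a, b} \<subseteq> ?U" using a b au nu nv bv by auto
        then have "card ?U \<ge> 2"
          using 3(1) fin card_mono[of ?U "{a, b}"] by simp
        then have "excess_bound ?U ?W'"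
          using less.hyps[of ?U ?W'] c by simp
        then show ?thesis using c by (simp add: excess_bound_def)
      qed
    qed
  qed
qed

section \<open>Cycles and components\<close>

text \<open>The end \<open>x\<close> is removed, and its neighbour becomes an end of the remaining
  path. Degree at most \<open>1\<close>, instead of equal to \<open>1\<close>, lets the induction
  start at a single vertex.\<close>

lemma path_enumeration:
  assumes "weighted V W" "conn V W" "x \<in> V" "deg V W x \<le> 1" "\<And>y. y \<in> V \<Longrightarrow> deg V W y \<le> 2"
    and "card V = Suc m"
  shows "\<exists>f. bij_betw f {..<Suc m} V \<and> f 0 = x \<and> edge_set V W = (\<lambda>i. {f i, f (Suc i)}) ` {..<m}"
  using assms
proof (induction m arbitrary: V x)
  case 0
  then have V: "V = {x}" by (auto simp: card_1_singleton_iff)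
  moreover have "edge_set {x} W = {}" using "0.prems"(1) V by (auto simp: edge_set_def weighted_def)
  ultimately show ?case by (intro exI[of _ "\<lambda>_. x"]) (auto simp: bij_betw_def lessThan_Suc)
next
  case (Suc m)
  note w = Suc.prems(1)
  have fin: "finite V" using w by (rule weighted_finite)
  have "deg V W x = 1"
    using conn_deg_pos[OF Suc.prems(2) fin _ Suc.prems(3)] Suc.prems(4,6) by simp
  then obtain y where nx: "nbs V W x = {y}" by (auto simp: card_1_singleton_iff)
  then have y: "y \<in> V" "W {x, y} \<noteq> 0" by (auto simp: nbs_def)
  then have xy: "x \<noteq> y" using w by (auto simp: weighted_def)
  let ?U = "V - {x}"
  have "deg V W y = deg ?U W y + 1"
    using deg_remove[OF fin Suc.prems(3), of W y] y by (simp add: insert_commute)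
  then have "deg ?U W y \<le> 1" using Suc.prems(5)[OF y(1)] by simp
  moreover have "deg ?U W z \<le> 2" if "z \<in> ?U" for z
    using deg_remove[OF fin Suc.prems(3), of W z] Suc.prems(5)[of z] that by simp
  moreover have "weighted ?U W" using w by (auto intro: weighted_subset)
  moreover have "card ?U = Suc m" using Suc.prems(3,6) by simp
  moreover have "y \<in> ?U" using y xy by simp
  ultimately obtain g where g: "bij_betw g {..<Suc m} ?U" "g 0 = y"
      "edge_set ?U W = (\<lambda>i. {g i, g (Suc i)}) ` {..<m}"
    using Suc.IH[of ?U y] conn_remove_pendant[OF Suc.prems(2) nx xy] by blast
  define f where "f = case_nat x g"
  have f: "f 0 = x" "\<And>i. f (Suc i) = g i" by (simp_all add: f_def)
  have split: "{..<Suc k} = insert 0 (Suc ` {..<k})" for k by (rule lessThan_Suc_eq_insert_0)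
  have "f ` {..<Suc (Suc m)} = insert x (g ` {..<Suc m})"
    unfolding split[of "Suc m"] by (simp add: image_image f)
  also have "\<dots> = V" using g(1) Suc.prems(3) by (auto simp: bij_betw_def)
  finally have "f ` {..<Suc (Suc m)} = V" .
  moreover from this have "inj_on f {..<Suc (Suc m)}"
    using Suc.prems(6) by (intro eq_card_imp_inj_on) auto
  ultimately have "bij_betw f {..<Suc (Suc m)} V" by (simp add: bij_betw_def)
  moreover have "edge_set V W = (\<lambda>i. {f i, f (Suc i)}) ` {..<Suc m}"
    unfolding edge_set_remove(1)[OF w Suc.prems(3)] g(3) nx split[of m]
    by (simp add: image_image f g(2))
  ultimately show ?case using f(1) by blast
qed

text \<open>Without \<open>v\<close> the cycle is a path that starts at one neighbour
  \<open>a\<close> of \<open>v\<close>; once the other neighbour \<open>b\<close> is known to be its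
  last vertex, \<open>v\<close> is appended at index \<open>m + 1\<close> and
  \<open>Suc i mod card V\<close> closes the cycle.\<close>

lemma cycle_enumeration:
  assumes w: "weighted V W" and conn: "conn V W" and reg: "\<And>x. x \<in> V \<Longrightarrow> deg V W x = 2"
  shows "3 \<le> card V \<and> (\<exists>f. bij_betw f {..<card V} V \<and>
     edge_set V W = (\<lambda>i. {f i, f (Suc i mod card V)}) ` {..<card V})"
proof -
  have fin: "finite V" using w by (rule weighted_finite)
  obtain v where v: "v \<in> V" using conn by (auto simp: conn_def)
  let ?U = "V - {v}"
  obtain a b where nv: "nbs V W v = {a, b}" "a \<noteq> b"
    using reg[OF v] by (auto simp: card_2_iff)
  have nb: "nbs V W v \<subseteq> ?U" using w v by (auto simp: nbs_def weighted_def)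
  then have ab: "a \<in> ?U" "b \<in> ?U" using nv by auto
  have wU: "weighted ?U W" using w by (auto intro: weighted_subset)
  have degU: "deg ?U W x = (if x \<in> {a, b} then 1 else 2)" if "x \<in> ?U" for x
  proof -
    have "W {x, v} \<noteq> 0 \<longleftrightarrow> x \<in> {a, b}"
      using nv(1) that by (auto simp: nbs_def insert_commute[of v])
    then show ?thesis using deg_remove[OF fin v, of W x] reg[of x] that by auto
  qed
  have "card {a, b} \<le> card ?U" using fin ab by (intro card_mono) auto
  then obtain m where m: "card ?U = Suc m" "m \<ge> 1" using nv(2)
    by (cases "card ?U") auto
  then have card: "card V = Suc (Suc m)"
    using v fin by (metis card_Suc_Diff1)
  have "\<exists>f. bij_betw f {..<Suc m} ?U \<and> f 0 = a \<and> edge_set ?U W = (\<lambda>i. {f i, f (Suc i)}) ` {..<m}"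
    using path_enumeration[OF wU conn_remove_2_regular[OF w conn reg v] ab(1) _ _ m(1)] degU ab by auto
  then obtain g where g: "bij_betw g {..<Suc m} ?U" "g 0 = a"
      "edge_set ?U W = (\<lambda>i. {g i, g (Suc i)}) ` {..<m}" by blast
  have inj: "g i = g j \<longleftrightarrow> i = j" if "i \<le> m" "j \<le> m" for i j
    using g(1) that by (auto simp: bij_betw_def inj_on_def)
  have gU: "g i \<in> ?U" if "i \<le> m" for i using g(1) that by (auto simp: bij_betw_def)
  have edge: "W {g i, g (Suc i)} \<noteq> 0" if "i < m" for i
  proof -
    have "{g i, g (Suc i)} \<in> edge_set ?U W" using g(3) that by blast
    then show ?thesis by (auto simp: edge_set_def)
  qed
  have "b \<in> g ` {..<Suc m}" using g(1) ab(2) unfolding bij_betw_def by blast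
  then obtain j where j: "j \<le> m" "b = g j" by (auto simp: less_Suc_eq_le)
  \<comment> \<open>An interior vertex of the path would have a predecessor and a successor as
    neighbours, whereas \<open>b\<close> has degree \<open>1\<close> after the removal of
    \<open>v\<close>.\<close>
  have "j = m"
  proof (rule ccontr)
    assume "j \<noteq> m"
    then have jm: "j < m" using j by simp
    have "j \<noteq> 0" using j(2) g(2) nv(2) by metis
    then obtain k where k: "j = Suc k" by (cases j) auto
    have "{g k, g (Suc j)} \<subseteq> nbs ?U W b"
      using edge[of k] edge[of j] gU[of k] gU[of "Suc j"] jm k j(2)
      by (auto simp: nbs_def insert_commute[of "g (Suc k)"])
    then have "card {g k, g (Suc j)} \<le> deg ?U W b"
      using fin by (intro card_mono) auto
    moreover have "g k \<noteq> g (Suc j)" using inj[of k "Suc j"] jm k by simp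
    ultimately show False using degU[OF ab(2)] by simp
  qed
  define f where "f i = (if i = Suc m then v else g i)" for i
  have "f ` {..<Suc (Suc m)} = insert v (g ` {..<Suc m})"
    unfolding lessThan_Suc[of "Suc m"] by (auto simp: f_def)
  also have "\<dots> = V" using g(1) v by (auto simp: bij_betw_def)
  finally have fV: "f ` {..<Suc (Suc m)} = V" .
  then have "inj_on f {..<Suc (Suc m)}" using card by (intro eq_card_imp_inj_on) auto
  then have bij: "bij_betw f {..<card V} V" using fV card by (simp add: bij_betw_def)
  have "(\<lambda>i. {f i, f (Suc i mod card V)}) ` {..<card V}
      = insert {v, a} (insert {b, v} ((\<lambda>i. {f i, f (Suc i mod card V)}) ` {..<m}))"
    unfolding card lessThan_Suc using g(2) j \<open>j = m\<close> by (simp add: f_def)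
  also have "(\<lambda>i. {f i, f (Suc i mod card V)}) ` {..<m} = (\<lambda>i. {g i, g (Suc i)}) ` {..<m}"
    by (rule image_cong) (auto simp: f_def card)
  finally have "edge_set V W = (\<lambda>i. {f i, f (Suc i mod card V)}) ` {..<card V}"
    unfolding edge_set_remove(1)[OF w v] g(3) nv(1) by (simp add: insert_commute)
  then show ?thesis using bij card m(2) by auto
qed

lemma cycle_conn_regular:
  assumes f: "bij_betw f {..<m} V" and m: "3 \<le> m"
    and edge_set: "edge_set V W = (\<lambda>i. {f i, f (Suc i mod m)}) ` {..<m}"
  shows "conn V W" "\<And>x. x \<in> V \<Longrightarrow> deg V W x = 2"
proof -
  have inj: "f i = f j \<longleftrightarrow> i = j" if "i < m" "j < m" for i j
    using f that by (auto simp: bij_betw_def inj_on_def)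
  have V: "V = f ` {..<m}" using f by (simp add: bij_betw_def)
  have edge: "W {f i, f (Suc i mod m)} \<noteq> 0" if "i < m" for i
  proof -
    have "{f i, f (Suc i mod m)} \<in> edge_set V W" using edge_set that by blast
    then show ?thesis by (auto simp: edge_set_def)
  qed
  have "conn (f ` {..<Suc k}) W" if "Suc k \<le> m" for k
    using that
  proof (induction k)
    case 0
    show ?case by (simp add: conn_single lessThan_Suc)
  next
    case (Suc k)
    then have "W {f k, f (Suc k)} \<noteq> 0" using edge[of k] by simp
    then have "conn (insert (f (Suc k)) (f ` {..<Suc k})) W"
      using Suc by (intro conn_insert[of _ _ "f k"]) auto
    then show ?case by (simp add: lessThan_Suc[of "Suc k"])
  qed
  from this[of "m - 1"] show "conn V W" using m V by simp
  fix x assume "x \<in> V"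
  then obtain i where i: "i < m" "x = f i" using V by auto
  define p where "p = (if i = 0 then m - 1 else i - 1)"
  have p: "p < m" "Suc p mod m = i" using i m by (auto simp: p_def)
  have "nbs V W x = {f (Suc i mod m), f p}"
  proof (intro equalityI subsetI)
    fix y assume "y \<in> nbs V W x"
    then obtain j where j: "j < m" "y = f j" "W {f i, f j} \<noteq> 0"
      using V i by (auto simp: nbs_def)
    then have "{f i, f j} \<in> edge_set V W" using i V by (auto simp: edge_set_def)
    then obtain k where k: "k < m" "{f i, f j} = {f k, f (Suc k mod m)}" using edge_set by auto
    have sk: "Suc k mod m < m" using m by simp
    consider "i = k" "j = Suc k mod m" | "i = Suc k mod m" "j = k"
      using k(2) inj[OF i(1) k(1)] inj[OF j(1) sk] inj[OF i(1) sk] inj[OF j(1) k(1)]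
      unfolding doubleton_eq_iff by blast
    then show "y \<in> {f (Suc i mod m), f p}"
    proof cases
      case 1
      then show ?thesis using j by simp
    next
      case 2
      then have "k = p" using k(1) by (auto simp: p_def mod_Suc split: if_splits)
      then show ?thesis using 2 j by simp
    qed
  next
    fix y assume "y \<in> {f (Suc i mod m), f p}"
    then show "y \<in> nbs V W x"
      using edge[OF i(1)] edge[OF p(1)] p m V i by (auto simp: nbs_def insert_commute)
  qed
  \<comment> \<open>This is where \<open>3 \<le> m\<close> matters: on two vertices, successor and
    predecessor coincide.\<close>
  moreover have "Suc i mod m \<noteq> p" using i m by (auto simp: p_def mod_Suc split: if_splits)
  then have "f (Suc i mod m) \<noteq> f p" using inj[of "Suc i mod m" p] p(1) m by simp
  ultimately show "deg V W x = 2" by simp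
qed

lemma pos_index_Union:
  assumes "finite F" "\<And>K. K \<in> F \<Longrightarrow> finite K"
    and "\<And>K L. K \<in> F \<Longrightarrow> L \<in> F \<Longrightarrow> K \<noteq> L \<Longrightarrow> K \<inter> L = {}"
    and "\<And>K L x y. K \<in> F \<Longrightarrow> L \<in> F \<Longrightarrow> K \<noteq> L \<Longrightarrow> x \<in> K \<Longrightarrow> y \<in> L \<Longrightarrow> W {x, y} = 0"
  shows "pos_index (\<Union>F) W = (\<Sum>K\<in>F. pos_index K W)"
  using assms
proof (induction F rule: finite_induct)
  case empty
  show ?case by (simp add: pos_index_eqI inertia_empty)
next
  case (insert K F)
  have IH: "pos_index (\<Union>F) W = (\<Sum>K\<in>F. pos_index K W)"
  proof (rule insert.IH)
    show "finite L" if "L \<in> F" for L using insert.prems(1) that by blast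
    show "L \<inter> M = {}" if "L \<in> F" "M \<in> F" "L \<noteq> M" for L M
      using insert.prems(2)[of L M] that by blast
    show "W {x, y} = 0" if "L \<in> F" "M \<in> F" "L \<noteq> M" "x \<in> L" "y \<in> M" for L M x y
      using insert.prems(3)[of L M x y] that by blast
  qed
  have fin: "finite K" "finite (\<Union>F)" using insert.hyps(1) insert.prems(1) by auto
  have ne: "L \<noteq> K" if "L \<in> F" for L using insert.hyps(2) that by blast
  have disj: "K \<inter> \<Union>F = {}" using insert.prems(2)[of K] ne by blast
  have cross: "W {x, y} = 0" if xy: "x \<in> K" "y \<in> \<Union>F" for x y
  proof -
    obtain L where "L \<in> F" "y \<in> L" using xy(2) by blast
    then show ?thesis using insert.prems(3)[of K L x y] ne xy(1) by blast
  qed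
  have "inertia (\<lambda>x y. W {x, y}) (K \<union> \<Union>F) (pos_index K W + pos_index (\<Union>F) W)"
  proof (rule inertia_disjoint_union[OF fin disj])
    show "W {i, j} = 0 \<and> W {j, i} = 0" if "i \<in> K" "j \<in> \<Union>F" for i j
      using cross[OF that] by (simp add: insert_commute)
  qed (rule inertia_pos_index, fact)+
  then have "pos_index (K \<union> \<Union>F) W = pos_index K W + pos_index (\<Union>F) W"
    using fin by (intro pos_index_eqI) auto
  then show ?case using insert.hyps IH by simp
qed

section \<open>Signed graphs as weighted graphs, and their components\<close>

definition weight :: "('a, 'b) sgraph_scheme \<Rightarrow> 'a set \<Rightarrow> real" where
  "weight \<Gamma> e = (if e \<in> edges \<Gamma> then real_of_int (esign \<Gamma> e) else 0)"

context
  fixes \<Gamma> :: "('a, 'b) sgraph_scheme"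
  assumes \<Gamma>: "signed_graph \<Gamma>"
begin

lemma finite_verts: "finite (verts \<Gamma>)"
  using \<Gamma> by (simp add: signed_graph_def)

lemma weight_nonzero: "weight \<Gamma> e \<noteq> 0 \<longleftrightarrow> e \<in> edges \<Gamma>"
  using \<Gamma> by (auto simp: weight_def signed_graph_def)

lemma edge_doubleton:
  assumes "e \<in> edges \<Gamma>"
  obtains x y where "e = {x, y}" "x \<in> verts \<Gamma>" "y \<in> verts \<Gamma>" "x \<noteq> y"
  using assms \<Gamma> by (force simp: signed_graph_def card_2_iff)

lemma weighted_weight: "weighted (verts \<Gamma>) (weight \<Gamma>)"
proof -
  have "{x} \<notin> edges \<Gamma>" for x using \<Gamma> by (force simp: signed_graph_def)
  then show ?thesis
    using \<Gamma> by (auto simp: weighted_def weight_def signed_graph_def)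
qed

lemma edges_eq_edge_set: "edges \<Gamma> = edge_set (verts \<Gamma>) (weight \<Gamma>)"
proof (intro equalityI subsetI)
  fix e assume e: "e \<in> edges \<Gamma>"
  then obtain x y where "e = {x, y}" "x \<in> verts \<Gamma>" "y \<in> verts \<Gamma>" by (rule edge_doubleton)
  then show "e \<in> edge_set (verts \<Gamma>) (weight \<Gamma>)" using e weight_nonzero by (auto simp: edge_set_def)
qed (auto simp: edge_set_def weight_nonzero)

lemma degree_of_eq_deg: "degree_of \<Gamma> x = deg (verts \<Gamma>) (weight \<Gamma>) x" if "x \<in> verts \<Gamma>"
proof -
  have "{e \<in> edges \<Gamma>. x \<in> e} = (\<lambda>y. {x, y}) ` nbs (verts \<Gamma>) (weight \<Gamma>) x"
  proof (intro equalityI subsetI)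
    fix e assume e: "e \<in> {e \<in> edges \<Gamma>. x \<in> e}"
    then obtain y z where yz: "e = {y, z}" "y \<in> verts \<Gamma>" "z \<in> verts \<Gamma>" by (auto elim: edge_doubleton)
    then have "e = {x, z} \<and> z \<in> verts \<Gamma> \<or> e = {x, y} \<and> y \<in> verts \<Gamma>" using e by auto
    then show "e \<in> (\<lambda>y. {x, y}) ` nbs (verts \<Gamma>) (weight \<Gamma>) x"
      using e weight_nonzero by (auto simp: nbs_def)
  qed (auto simp: nbs_def weight_nonzero)
  then show ?thesis by (simp add: degree_of_def card_image inj_doubleton)
qed

lemma pos_inertia_eq_pos_index: "pos_inertia \<Gamma> = pos_index (verts \<Gamma>) (weight \<Gamma>)"
proof -
  have "adj_entry \<Gamma> = (\<lambda>x y. weight \<Gamma> {x, y})"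
    by (intro ext) (simp add: adj_entry_def weight_def)
  then show ?thesis using inertia_pos_inertia[OF \<Gamma>] pos_index_eqI[OF finite_verts] by metis
qed

lemma equiv_reachable:
  "equiv (verts \<Gamma>)
    {(u, v). u \<in> verts \<Gamma> \<and> v \<in> verts \<Gamma> \<and> (adjacent \<Gamma>)\<^sup>*\<^sup>* u v}"
  (is "equiv _ ?R")
proof (rule equivI)
  have "symp (adjacent \<Gamma>)" by (auto simp: symp_def adjacent_def insert_commute)
  then show "sym ?R" by (auto simp: sym_def dest: symp_rtranclp[THEN sympD])
  show "trans ?R" by (auto simp: trans_def)
qed (auto simp: refl_on_def)

lemma Union_components: "\<Union>(components \<Gamma>) = verts \<Gamma>"
  unfolding components_def by (rule Union_quotient[OF equiv_reachable])

lemma finite_components: "finite (components \<Gamma>)"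
  using finite_verts Union_components by (metis finite_UnionD)

lemma components_disjoint:
  "K \<in> components \<Gamma> \<Longrightarrow> L \<in> components \<Gamma> \<Longrightarrow> K \<noteq> L \<Longrightarrow> K \<inter> L = {}"
  unfolding components_def using quotient_disj[OF equiv_reachable] by blast

lemma component_eq:
  assumes "K \<in> components \<Gamma>" "x \<in> K"
  shows "K = {y \<in> verts \<Gamma>. (adjacent \<Gamma>)\<^sup>*\<^sup>* x y}" "x \<in> verts \<Gamma>"
proof -
  let ?R = "{(u, v). u \<in> verts \<Gamma> \<and> v \<in> verts \<Gamma> \<and> (adjacent \<Gamma>)\<^sup>*\<^sup>* u v}"
  obtain z where z: "z \<in> verts \<Gamma>" "K = ?R `` {z}"
    using assms(1) unfolding components_def by (rule quotientE)
  then have "(z, x) \<in> ?R" using assms(2) by blast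
  then have "K = ?R `` {x}" using equiv_class_eq[OF equiv_reachable] z(2) by simp
  then show "K = {y \<in> verts \<Gamma>. (adjacent \<Gamma>)\<^sup>*\<^sup>* x y}" "x \<in> verts \<Gamma>" using \<open>(z, x) \<in> ?R\<close> by auto
qed

lemma adjacent_verts: "adjacent \<Gamma> x y \<Longrightarrow> x \<in> verts \<Gamma> \<and> y \<in> verts \<Gamma>"
  using \<Gamma> by (auto simp: adjacent_def signed_graph_def)

lemma component_nbs:
  assumes "K \<in> components \<Gamma>" "x \<in> K"
  shows "nbs (verts \<Gamma>) (weight \<Gamma>) x \<subseteq> K"
  using component_eq[OF assms] by (auto simp: nbs_def weight_nonzero adjacent_def)

text \<open>A vertex set inside \<open>K\<close> that no edge leaves is closed under walks, and any
  two vertices of \<open>K\<close> are joined by a walk.\<close>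

lemma component_conn:
  assumes K: "K \<in> components \<Gamma>"
  shows "conn K (weight \<Gamma>)"
proof -
  have "\<exists>x\<in>S. \<exists>y\<in>K - S. weight \<Gamma> {x, y} \<noteq> 0" if S: "S \<subseteq> K" "S \<noteq> {}" "S \<noteq> K" for S
  proof (rule ccontr)
    assume none: "\<not> ?thesis"
    obtain s t where st: "s \<in> S" "t \<in> K" "t \<notin> S" using S by blast
    have "(adjacent \<Gamma>)\<^sup>*\<^sup>* s t" using component_eq[OF K, of s] st S by blast
    then have "t \<in> S"
    proof (induction rule: rtranclp_induct)
      case (step y z)
      then have "weight \<Gamma> {y, z} \<noteq> 0" by (simp add: weight_nonzero adjacent_def)
      moreover have "z \<in> K"
        using component_nbs[OF K, of y] step S adjacent_verts[OF step(2)] \<open>weight \<Gamma> {y, z} \<noteq> 0\<close>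
        by (auto simp: nbs_def)
      ultimately show ?case using none step.IH by blast
    qed (fact st(1))
    then show False using st by simp
  qed
  moreover have "K \<noteq> {}"
    using K in_quotient_imp_non_empty[OF equiv_reachable] unfolding components_def by blast
  ultimately show ?thesis unfolding conn_def by blast
qed

lemma component_subset: "K \<in> components \<Gamma> \<Longrightarrow> K \<subseteq> verts \<Gamma>"
  using Union_components by blast

lemma component_weighted: "K \<in> components \<Gamma> \<Longrightarrow> weighted K (weight \<Gamma>)"
  by (rule weighted_subset[OF weighted_weight component_subset])

lemma component_deg:
  assumes "K \<in> components \<Gamma>" "x \<in> K"
  shows "deg K (weight \<Gamma>) x = deg (verts \<Gamma>) (weight \<Gamma>) x"
proof -
  have "nbs K (weight \<Gamma>) x = nbs (verts \<Gamma>) (weight \<Gamma>) x"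
    using component_nbs[OF assms] component_subset[OF assms(1)] by (auto simp: nbs_def)
  then show ?thesis by simp
qed

text \<open>The intersection \<open>K \<inter> L\<close> is closed under neighbours within
  \<open>K\<close> and within \<open>L\<close>, so both connected sets coincide with it. This
  identifies the cycles of a given disjoint union with components.\<close>

lemma conn_closed_component:
  assumes "conn L (weight \<Gamma>)" "L \<subseteq> verts \<Gamma>" "\<And>y. y \<in> L \<Longrightarrow> nbs (verts \<Gamma>) (weight \<Gamma>) y \<subseteq> L"
    and K: "K \<in> components \<Gamma>" and "x \<in> K" "x \<in> L"
  shows "K = L"
proof -
  have "K = K \<inter> L"
    using component_subset[OF K] assms(3,5,6)
    by (intro conn_closed[OF component_conn[OF K]]) (auto simp: nbs_def)
  moreover have "L = K \<inter> L"
    using component_nbs[OF K] assms(2,5,6)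
    by (intro conn_closed[OF assms(1)]) (auto simp: nbs_def)
  ultimately show ?thesis by blast
qed

lemma sum_components:
  fixes h :: "'a \<Rightarrow> 'c :: comm_monoid_add"
  shows "(\<Sum>K\<in>components \<Gamma>. \<Sum>x\<in>K. h x) = (\<Sum>x\<in>verts \<Gamma>. h x)"
  using finite_verts component_subset components_disjoint
  by (subst Union_components[symmetric], subst sum.Union_disjoint)
    (auto intro: finite_subset)

text \<open>Degrees add up to \<open>2 * card (edges \<Gamma>)\<close> and the constant
  \<open>2\<close> counts components. Of the \<open>-3\<close> per vertex in \<open>phi\<close>, a
  share of \<open>-2\<close> belongs to \<open>2 * cyclomatic \<Gamma>\<close> and \<open>-1\<close>
  to the order.\<close>

lemma sum_excess_components:
  "(\<Sum>K\<in>components \<Gamma>. excess K (weight \<Gamma>))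
     = 2 * int (pos_inertia \<Gamma>) + 2 * cyclomatic \<Gamma> + int (num_pendant \<Gamma>) - int (card (verts \<Gamma>))"
proof -
  have "(\<Sum>K\<in>components \<Gamma>. pos_index K (weight \<Gamma>)) = pos_index (\<Union>(components \<Gamma>)) (weight \<Gamma>)"
  proof (rule pos_index_Union[symmetric, OF finite_components])
    show "weight \<Gamma> {x, y} = 0" if "K \<in> components \<Gamma>" "L \<in> components \<Gamma>" "K \<noteq> L" "x \<in> K" "y \<in> L" for K L x y
      using component_nbs[OF that(1,4)] components_disjoint[OF that(1-3)] that(5)
        component_subset[OF that(2)] by (auto simp: nbs_def)
    show "finite K" if "K \<in> components \<Gamma>" for K
      using component_subset[OF that] finite_verts by (rule finite_subset)
  qed (rule components_disjoint)
  then have pos_index: "(\<Sum>K\<in>components \<Gamma>. int (pos_index K (weight \<Gamma>))) = int (pos_inertia \<Gamma>)"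
    by (simp add: Union_components pos_inertia_eq_pos_index flip: of_nat_sum)
  have "(\<Sum>K\<in>components \<Gamma>. \<Sum>x\<in>K. phi (deg K (weight \<Gamma>) x))
      = (\<Sum>x\<in>verts \<Gamma>. phi (deg (verts \<Gamma>) (weight \<Gamma>) x))"
    unfolding sum_components[symmetric] by (intro sum.cong refl) (simp add: component_deg)
  also have "\<dots> = int (\<Sum>x\<in>verts \<Gamma>. deg (verts \<Gamma>) (weight \<Gamma>) x)
      - 3 * int (card (verts \<Gamma>)) + int (card {x \<in> verts \<Gamma>. deg (verts \<Gamma>) (weight \<Gamma>) x = 1})"
    using finite_verts by (simp add: phi_def sum.distrib sum_subtractf sum.If_cases Int_def)
  also have "{x \<in> verts \<Gamma>. deg (verts \<Gamma>) (weight \<Gamma>) x = 1} = {x \<in> verts \<Gamma>. degree_of \<Gamma> x = 1}"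
    using degree_of_eq_deg by auto
  also have "(\<Sum>x\<in>verts \<Gamma>. deg (verts \<Gamma>) (weight \<Gamma>) x) = 2 * card (edges \<Gamma>)"
    unfolding edges_eq_edge_set by (rule handshake[OF weighted_weight])
  finally show ?thesis
    using pos_index by (simp add: excess_def sum.distrib num_pendant_def cyclomatic_def flip: sum_distrib_left)
qed

text \<open>The difference of the two sides is half a sum of nonnegative excesses, which vanishes
  only if every summand does.\<close>

lemma equality_iff_extremal:
  assumes "\<And>K. K \<in> components \<Gamma> \<Longrightarrow> card K \<ge> 2"
  shows "real (pos_inertia \<Gamma>) = (real (card (verts \<Gamma>)) - real (num_pendant \<Gamma>)) / 2 - real_of_int (cyclomatic \<Gamma>)
    \<longleftrightarrow> (\<forall>K\<in>components \<Gamma>. extremal K (weight \<Gamma>))"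
proof -
  have bound: "excess_bound K (weight \<Gamma>)" if "K \<in> components \<Gamma>" for K
    by (rule excess_bound[OF component_weighted component_conn assms]) (fact that)+
  have "real (pos_inertia \<Gamma>) = (real (card (verts \<Gamma>)) - real (num_pendant \<Gamma>)) / 2 - real_of_int (cyclomatic \<Gamma>)
    \<longleftrightarrow> real_of_int (\<Sum>K\<in>components \<Gamma>. excess K (weight \<Gamma>)) = 0"
    unfolding sum_excess_components by (simp add: field_simps)
  also have "\<dots> \<longleftrightarrow> (\<Sum>K\<in>components \<Gamma>. excess K (weight \<Gamma>)) = 0" by linarith
  also have "\<dots> \<longleftrightarrow> (\<forall>K\<in>components \<Gamma>. excess K (weight \<Gamma>) = 0)"
    using bound finite_components by (intro sum_nonneg_eq_0_iff) (auto simp: excess_bound_def)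
  also have "\<dots> \<longleftrightarrow> (\<forall>K\<in>components \<Gamma>. extremal K (weight \<Gamma>))"
    using bound by (auto simp: excess_bound_def)
  finally show ?thesis .
qed

end

section \<open>From extremal components to balanced and unbalanced cycles\<close>

lemma minus_one_power_half:
  assumes "even m"
  shows "(-1 :: real) ^ (m div 2) = (if m mod 4 = 0 then 1 else -1)" "m mod 4 = 0 \<or> m mod 4 = 2"
proof -
  have "even (m div 2) \<longleftrightarrow> m mod 4 = 0" using assms by presburger
  then show "(-1 :: real) ^ (m div 2) = (if m mod 4 = 0 then 1 else -1)"
    by (simp add: minus_one_power_iff)
  show "m mod 4 = 0 \<or> m mod 4 = 2" using assms by presburger
qed

lemma cycle_sign_cases:
  assumes "signed_graph C"
  shows "cycle_sign C = 1 \<or> cycle_sign C = -1"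
proof -
  have "\<bar>cycle_sign C\<bar> = 1"
    unfolding cycle_sign_def abs_prod using assms by (intro prod.neutral) (auto simp: signed_graph_def)
  then show ?thesis by linarith
qed

theorem theorem3p2:
  fixes \<Gamma> :: "'a sgraph" and n :: nat
  assumes "signed_graph \<Gamma>"
    and "card (verts \<Gamma>) = n"
    and "\<And>K. K \<in> components \<Gamma> \<Longrightarrow> card K \<ge> 2"
  shows "real (pos_inertia \<Gamma>) = (real n - real (num_pendant \<Gamma>)) / 2 - real_of_int (cyclomatic \<Gamma>)
    \<longleftrightarrow>
    (\<exists>(t :: nat) (m :: nat \<Rightarrow> nat) (C :: nat \<Rightarrow> 'a sgraph).
       is_disjoint_union \<Gamma> {1..t} C \<and>
       (\<forall>i\<in>{1..t}. signed_cycle (m i) (C i)) \<and>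
       (\<Sum>i=1..t. m i) = n \<and>
       (\<forall>i\<in>{1..t}. (balanced_cycle (C i) \<longrightarrow> m i mod 4 = 0) \<and>
                    (unbalanced_cycle (C i) \<longrightarrow> m i mod 4 = 2)))"
    (is "?eq \<longleftrightarrow> (\<exists>t m C. ?cycles t m C)")
proof -
  note \<Gamma> = assms(1)
  let ?W = "weight \<Gamma>"
  have "?eq \<longleftrightarrow> (\<forall>K\<in>components \<Gamma>. extremal K ?W)"
    using equality_iff_extremal[OF \<Gamma> assms(3)] assms(2) by simp
  also have "\<dots> \<longleftrightarrow> (\<exists>t m C. ?cycles t m C)"
  proof
    assume extremal: "\<forall>K\<in>components \<Gamma>. extremal K ?W"
    obtain h where h: "bij_betw h {1..card (components \<Gamma>)} (components \<Gamma>)"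
      using ex_bij_betw_nat_finite_1[OF finite_components[OF \<Gamma>]] by blast
    define t where "t = card (components \<Gamma>)"
    define C where "C i = \<lparr>verts = h i, edges = edge_set (h i) ?W, esign = esign \<Gamma>\<rparr>" for i
    have hK: "h i \<in> components \<Gamma>" if "i \<in> {1..t}" for i
      using h that by (auto simp: bij_betw_def t_def)
    have sub: "edge_set (h i) ?W \<subseteq> edges \<Gamma>" for i
      by (auto simp: edge_set_def weight_nonzero[OF \<Gamma>])
    have Uh: "(\<Union>i\<in>{1..t}. h i) = verts \<Gamma>"
      using h Union_components[OF \<Gamma>] by (simp add: bij_betw_def t_def)
    have "is_disjoint_union \<Gamma> {1..t} C"
      unfolding is_disjoint_union_def
    proof (intro conjI)
      show "disjoint_family_on (\<lambda>i. verts (C i)) {1..t}"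
        unfolding disjoint_family_on_def
      proof (intro ballI impI)
        fix i j assume ij: "i \<in> {1..t}" "j \<in> {1..t}" "i \<noteq> j"
        then have "h i \<noteq> h j" using h by (auto simp: bij_betw_def t_def dest: inj_onD)
        then show "verts (C i) \<inter> verts (C j) = {}"
          using components_disjoint[OF \<Gamma> hK[OF ij(1)] hK[OF ij(2)]] by (simp add: C_def)
      qed
      show "verts \<Gamma> = (\<Union>i\<in>{1..t}. verts (C i))" using Uh by (simp add: C_def)
      have "e \<in> (\<Union>i\<in>{1..t}. edge_set (h i) ?W)" if e: "e \<in> edges \<Gamma>" for e
      proof -
        obtain x y where xy: "e = {x, y}" "x \<in> verts \<Gamma>" "y \<in> verts \<Gamma>"
          using edge_doubleton[OF \<Gamma> e] by blast
        then obtain i where i: "i \<in> {1..t}" "x \<in> h i" using Uh by blast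
        have W: "?W {x, y} \<noteq> 0" using e xy weight_nonzero[OF \<Gamma>] by simp
        then have "y \<in> h i" using component_nbs[OF \<Gamma> hK[OF i(1)] i(2)] xy(3) by (auto simp: nbs_def)
        then have "e \<in> edge_set (h i) ?W" using W xy i(2) by (auto simp: edge_set_def)
        then show ?thesis using i by blast
      qed
      then show "edges \<Gamma> = (\<Union>i\<in>{1..t}. edges (C i))" using sub by (auto simp: C_def)
    qed (simp add: C_def)
    moreover have cyc: "signed_cycle (card (h i)) (C i) \<and>
        (balanced_cycle (C i) \<longrightarrow> card (h i) mod 4 = 0) \<and>
        (unbalanced_cycle (C i) \<longrightarrow> card (h i) mod 4 = 2)" if i: "i \<in> {1..t}" for i
    proof -
      have g: "extremal (h i) ?W" using extremal hK[OF i] by blast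
      have w: "weighted (h i) ?W" by (rule component_weighted[OF \<Gamma> hK[OF i]])
      have "e \<subseteq> h i" if "e \<in> edge_set (h i) ?W" for e using that by (auto simp: edge_set_def)
      then have "signed_graph (C i)"
        using \<Gamma> sub[of i] weighted_finite[OF w] by (auto simp: signed_graph_def C_def)
      then have "signed_cycle (card (h i)) (C i)"
        using cycle_enumeration[OF w component_conn[OF \<Gamma> hK[OF i]]] g
        by (simp add: signed_cycle_def C_def extremal_def)
      moreover have "real_of_int (cycle_sign (C i)) = (\<Prod>e\<in>edge_set (h i) ?W. ?W e)"
        unfolding cycle_sign_def C_def using sub[of i]
        by (auto simp: weight_def intro!: prod.cong)
      then have "real_of_int (cycle_sign (C i)) = (if card (h i) mod 4 = 0 then 1 else -1)"
        using g minus_one_power_half(1) by (simp add: extremal_def)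
      moreover have "card (h i) mod 4 = 0 \<or> card (h i) mod 4 = 2"
        using g minus_one_power_half(2) by (simp add: extremal_def)
      ultimately show ?thesis
        by (auto simp: balanced_cycle_def unbalanced_cycle_def split: if_splits)
    qed
    moreover have "(\<Sum>i=1..t. card (h i)) = n"
    proof -
      have "(\<Sum>i=1..t. card (h i)) = (\<Sum>K\<in>components \<Gamma>. \<Sum>x\<in>K. 1)"
        using sum.reindex_bij_betw[OF h, of card] by (simp add: t_def)
      also have "\<dots> = n" unfolding sum_components[OF \<Gamma>] using assms(2) by simp
      finally show ?thesis .
    qed
    ultimately have "?cycles t (\<lambda>i. card (h i)) C" by blast
    then show "\<exists>t m C. ?cycles t m C"
      by (intro exI[of _ t] exI[of _ "\<lambda>i. card (h i)"] exI[of _ C])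
  next
    assume "\<exists>t m C. ?cycles t m C"
    then obtain t m and C :: "nat \<Rightarrow> 'a sgraph" where C: "?cycles t m C" by blast
    then have disj: "disjoint_family_on (\<lambda>i. verts (C i)) {1..t}"
      and verts: "verts \<Gamma> = (\<Union>i\<in>{1..t}. verts (C i))"
      and edges: "edges \<Gamma> = (\<Union>i\<in>{1..t}. edges (C i))"
      and esign: "\<And>i e. i \<in> {1..t} \<Longrightarrow> e \<in> edges (C i) \<Longrightarrow> esign \<Gamma> e = esign (C i) e"
      unfolding is_disjoint_union_def by blast+
    show "\<forall>K\<in>components \<Gamma>. extremal K ?W"
    proof
      fix K assume K: "K \<in> components \<Gamma>"
      then obtain x where x: "x \<in> K" using component_conn[OF \<Gamma>] by (auto simp: conn_def)
      then obtain i where i: "i \<in> {1..t}" "x \<in> verts (C i)"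
        using component_subset[OF \<Gamma> K] unfolding verts by blast
      let ?L = "verts (C i)"
      have sc: "signed_cycle (m i) (C i)" using C i by blast
      then have sg: "signed_graph (C i)" and m: "3 \<le> m i" by (auto simp: signed_cycle_def)
      have LV: "?L \<subseteq> verts \<Gamma>" using i(1) unfolding verts by blast
      \<comment> \<open>Because the vertex sets are disjoint, an edge meeting \<open>?L\<close> can
        only come from \<open>C i\<close>. Hence \<open>?L\<close> is closed under neighbours in
        \<open>\<Gamma>\<close>, and since it is connected it is a whole component.\<close>
      have touching: "e \<in> edges (C i)" if ye: "e \<in> edges \<Gamma>" "y \<in> e" "y \<in> ?L" for e y
      proof -
        obtain j where j: "j \<in> {1..t}" "e \<in> edges (C j)"
          using ye(1) unfolding edges by blast
        then have "signed_graph (C j)" using C unfolding signed_cycle_def by blast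
        then have "y \<in> verts (C j)" using j ye(2) unfolding signed_graph_def by blast
        then have "j = i" using disj i(1) j(1) ye(3) unfolding disjoint_family_on_def by blast
        then show ?thesis using j by simp
      qed
      have edge_set: "edge_set ?L ?W = edges (C i)"
      proof (intro equalityI subsetI)
        fix e assume "e \<in> edge_set ?L ?W"
        then show "e \<in> edges (C i)"
          using touching weight_nonzero[OF \<Gamma>] by (auto simp: edge_set_def)
      next
        fix e assume e: "e \<in> edges (C i)"
        then have W: "?W e \<noteq> 0" using i(1) unfolding weight_nonzero[OF \<Gamma>] edges by blast
        obtain y z where "e = {y, z}" "y \<in> ?L" "z \<in> ?L" by (rule edge_doubleton[OF sg e])
        then show "e \<in> edge_set ?L ?W" using W by (auto simp: edge_set_def)
      qed
      obtain f where f: "bij_betw f {..<m i} ?L"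
          "edges (C i) = (\<lambda>k. {f k, f (Suc k mod m i)}) ` {..<m i}"
        using sc by (auto simp: signed_cycle_def)
      note cyc = cycle_conn_regular[OF f(1) m edge_set[unfolded f(2)]]
      have "nbs (verts \<Gamma>) ?W y \<subseteq> ?L" if "y \<in> ?L" for y
      proof
        fix z assume "z \<in> nbs (verts \<Gamma>) ?W y"
        then have "{y, z} \<in> edges (C i)"
          using touching[of "{y, z}" y] that weight_nonzero[OF \<Gamma>] by (auto simp: nbs_def)
        then show "z \<in> ?L" using sg by (auto simp: signed_graph_def)
      qed
      then have KL: "K = ?L"
        using conn_closed_component[OF \<Gamma> cyc(1) LV _ K x i(2)] by blast
      have card: "card K = m i" using bij_betw_same_card[OF f(1)] KL by simp
      have "(\<Prod>e\<in>edge_set K ?W. ?W e) = real_of_int (cycle_sign (C i))"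
        unfolding cycle_sign_def KL edge_set of_int_prod
        by (intro prod.cong refl) (use i(1) esign edges in \<open>auto simp: weight_def\<close>)
      \<comment> \<open>A cycle sign is \<open>1\<close> or \<open>-1\<close>, so exactly one of the
        two implications is active; evenness of the order follows from either residue.\<close>
      moreover have "cycle_sign (C i) = 1 \<and> m i mod 4 = 0 \<or> cycle_sign (C i) = -1 \<and> m i mod 4 = 2"
        using cycle_sign_cases[OF sg] C i(1) unfolding balanced_cycle_def unbalanced_cycle_def by blast
      moreover from this have "even (m i)" by presburger
      ultimately show "extremal K ?W"
        unfolding extremal_def card using cyc(2) KL minus_one_power_half(1)[of "m i"] by auto
    qed
  qed
  finally show ?thesis .
qed

end
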